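(* Let $X$ be a separable Hilbert space and let $\mu^{(n)} = \mathcal{N}(m^{(n)}, C^{(n)})$, $n \in \mathbb{N}$, and $\mu = \mathcal{N}(m, C)$ be Gaussian measures on $X$ such that $m^{(n)} \to m$ in $X$ and $C^{(n)} \to C$ with respect to the operator norm. Then $I_{\mu} = \Gamma\text{-}\lim_{n \to \infty} I_{\mu^{(n)}}$. Furthermore, the sequence $(I_{\mu^{(n)}})_{n \in \mathbb{N}}$ is equicoercive.
   Context: $X$ is a real Hilbert space and $\overline{\mathbb{R}} = \mathbb{R} \cup \{\pm\infty\}$. Covariances of Gaussian measures are interpreted as self-adjoint positive semi-definite (trace-class) operators on $X$ and are not assumed to be injective. For such an operator $C = \sum_{n} \sigma_n^2\, e_n \otimes e_n$ with $(e_n)$ orthonormal and $\sigma_n \geq 0$, $C^{1/2} = \sum_n \sigma_n\, e_n \otimes e_n$ is its square root and $C^{\dagger/2} = (C^{1/2})^{\dagger} = \sum_{n : \sigma_n \neq 0} \sigma_n^{-1}\, e_n \otimes e_n$ is the Moore--Penrose pseudoinverse of $C^{1/2}$; on $\operatorname{ran} C^{1/2}$, $C^{\dagger/2}y$ is the minimum-norm solution $x$ of $C^{1/2}x = y$. The (extended) Onsager--Machlup functional $I_\mu \colon X \to \overline{\mathbb{R}}$ of $\mu = \mathcal{N}(m, C)$ is $$I_\mu(u) = \tfrac12 \|C^{\dagger/2}(u - m)\|_X^2 \text{ if } u - m \in \operatorname{ran} C^{1/2}, \qquad I_\mu(u) = +\infty \text{ otherwise},$$ and likewise $I_{\mu^{(n)}}$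 with $m^{(n)}, C^{(n)}$ in place of $m, C$. $\Gamma$-convergence: functions $F_n \colon X \to \overline{\mathbb{R}}$ $\Gamma$-converge to $F \colon X \to \overline{\mathbb{R}}$, written $F = \Gamma\text{-}\lim_{n\to\infty} F_n$, if for every $x \in X$: (i) for every sequence $x_n \to x$ (in norm), $F(x) \leq \liminf_{n} F_n(x_n)$; and (ii) there exists a sequence $x_n \to x$ with $F(x) \geq \limsup_{n} F_n(x_n)$. Equicoercivity: $(F_n)_{n \in \mathbb{N}}$ is equicoercive if for all $t \in \mathbb{R}$ there is a compact $K_t \subseteq X$ such that $F_n^{-1}([-\infty, t]) \subseteq K_t$ for all $n \in \mathbb{N}$. *)

theory Defs
  imports "HOL-Probability.Probability"
begin

definition orthonormal :: "'a::real_inner set \<Rightarrow> bool" where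
  "orthonormal E \<longleftrightarrow> (\<forall>e\<in>E. norm e = 1) \<and> pairwise orthogonal E"

definition orthonormal_basis :: "'a::real_inner set \<Rightarrow> bool" where
  "orthonormal_basis B \<longleftrightarrow> orthonormal B \<and> closure (span B) = UNIV"

definition self_adjoint :: "('a::real_inner \<Rightarrow>\<^sub>L 'a) \<Rightarrow> bool" where
  "self_adjoint T \<longleftrightarrow> (\<forall>x y. blinfun_apply T x \<bullet> y = x \<bullet> blinfun_apply T y)"

definition positive_semidefinite :: "('a::real_inner \<Rightarrow>\<^sub>L 'a) \<Rightarrow> bool" where
  "positive_semidefinite T \<longleftrightarrow> (\<forall>x. 0 \<le> x \<bullet> blinfun_apply T x)"

(* For self-adjoint positive semi-definite T one has |T| = T, so this is the trace-class property;
   the sum does not depend on the basis. It is not the trace-class property for general T. *)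
definition finite_trace :: "('a::real_inner \<Rightarrow>\<^sub>L 'a) \<Rightarrow> bool" where
  "finite_trace T \<longleftrightarrow> (\<exists>B. orthonormal_basis B \<and> (\<lambda>e. e \<bullet> blinfun_apply T e) summable_on B)"

definition covariance_operator :: "('a::real_inner \<Rightarrow>\<^sub>L 'a) \<Rightarrow> bool" where
  "covariance_operator C \<longleftrightarrow> self_adjoint C \<and> positive_semidefinite C \<and> finite_trace C"

(* M = N(m, C), identified by its characteristic functional. C need not be injective. *)
definition gaussian_measure ::
    "'a::real_inner measure \<Rightarrow> 'a \<Rightarrow> ('a \<Rightarrow>\<^sub>L 'a) \<Rightarrow> bool" where
  "gaussian_measure M m C \<longleftrightarrow>
     prob_space M \<and> sets M = sets borel \<and> covariance_operator C \<and>
     (\<forall>h. (CLINT x|M. iexp (h \<bullet> x)) =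
        exp (\<i> * complex_of_real (h \<bullet> m) - complex_of_real (h \<bullet> blinfun_apply C h) / 2))"

(* The characteristic functional determines m and C, so both descriptions below are definite
   whenever M is Gaussian. *)
definition gaussian_mean :: "'a::real_inner measure \<Rightarrow> 'a" where
  "gaussian_mean M = (THE m. \<exists>C. gaussian_measure M m C)"

definition gaussian_cov :: "'a::real_inner measure \<Rightarrow> ('a \<Rightarrow>\<^sub>L 'a)" where
  "gaussian_cov M = (THE C. \<exists>m. gaussian_measure M m C)"

(* C is the sum of sigma(e)^2 (e \<otimes> e) over e in E. The orthonormal system is indexed by its own
   elements, which covers finite and countably infinite systems alike. *)
definition spectral_decomposition ::
    "('a::real_inner \<Rightarrow>\<^sub>L 'a) \<Rightarrow> 'a set \<Rightarrow> ('a \<Rightarrow> real) \<Rightarrow> bool" where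
  "spectral_decomposition C E \<sigma> \<longleftrightarrow>
     orthonormal E \<and> (\<forall>e\<in>E. 0 \<le> \<sigma> e) \<and>
     (\<forall>x. ((\<lambda>e. ((\<sigma> e)\<^sup>2 * (e \<bullet> x)) *\<^sub>R e) has_sum blinfun_apply C x) E)"

(* The decomposition is not unique, but the square root, and the pseudoinverse of the square root
   on the range of the square root, do not depend on the choice. *)
definition spectral_choice :: "('a::real_inner \<Rightarrow>\<^sub>L 'a) \<Rightarrow> 'a set \<times> ('a \<Rightarrow> real)" where
  "spectral_choice C = (SOME p. spectral_decomposition C (fst p) (snd p))"

definition cov_sqrt :: "('a::real_inner \<Rightarrow>\<^sub>L 'a) \<Rightarrow> 'a \<Rightarrow> 'a" where
  "cov_sqrt C x = (case spectral_choice C of (E, \<sigma>) \<Rightarrow>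
     \<Sum>\<^sub>\<infinity>e\<in>E. (\<sigma> e * (e \<bullet> x)) *\<^sub>R e)"

(* Meaningful on the range of cov_sqrt C only; where the series diverges, infsum returns 0. *)
definition cov_sqrt_pinv :: "('a::real_inner \<Rightarrow>\<^sub>L 'a) \<Rightarrow> 'a \<Rightarrow> 'a" where
  "cov_sqrt_pinv C y = (case spectral_choice C of (E, \<sigma>) \<Rightarrow>
     \<Sum>\<^sub>\<infinity>e\<in>{e\<in>E. \<sigma> e \<noteq> 0}. (inverse (\<sigma> e) * (e \<bullet> y)) *\<^sub>R e)"

definition onsager_machlup :: "'a::real_inner measure \<Rightarrow> 'a \<Rightarrow> ereal" where
  "onsager_machlup M u =
     (let m = gaussian_mean M; C = gaussian_cov M in
      if u - m \<in> range (cov_sqrt C)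
      then ereal (1 / 2 * (norm (cov_sqrt_pinv C (u - m)))\<^sup>2)
      else \<infinity>)"

definition gamma_converges ::
    "(nat \<Rightarrow> 'a::topological_space \<Rightarrow> ereal) \<Rightarrow> ('a \<Rightarrow> ereal) \<Rightarrow> bool" where
  "gamma_converges Fs F \<longleftrightarrow>
     (\<forall>x. (\<forall>xs. xs \<longlonglongrightarrow> x \<longrightarrow> F x \<le> liminf (\<lambda>n. Fs n (xs n))) \<and>
          (\<exists>xs. xs \<longlonglongrightarrow> x \<and> F x \<ge> limsup (\<lambda>n. Fs n (xs n))))"

definition equicoercive :: "(nat \<Rightarrow> 'a::topological_space \<Rightarrow> ereal) \<Rightarrow> bool" where
  "equicoercive Fs \<longleftrightarrow>
     (\<forall>t::real. \<exists>K. compact K \<and> (\<forall>n. Fs n -` {-\<infinity>..ereal t} \<subseteq> K))"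

end

theory Submission imports Defs begin

text \<open>
  The idea is to replace the square root and the pseudoinverse by convex duality. Up to translation
  by the mean, the Onsager--Machlup functional of a Gaussian measure is the convex conjugate
  \<open>J v = (SUP h. h \<bullet> v - (h \<bullet> C h) / 2)\<close> of the quadratic form of its covariance
  (\<open>onsager_machlup_le_iff\<close>). In this form the functional depends on \<open>C\<close> only through the quadratic
  form, and so continuously for each fixed \<open>h\<close>.

  The lower bound holds because a supremum of continuous expressions is lower semicontinuous, here
  jointly in the point, the mean and the covariance. For the upper bound, \<open>J (C h) \<le> (h \<bullet> C h) / 2\<close>, with
  both \<open>C h\<close> and \<open>(h \<bullet> C h) / 2\<close> continuous in \<open>C\<close> for fixed \<open>h\<close>. Points of the form \<open>m + C h\<close> approximate
  every point of finite energy without raising the energy, and a diagonal argument produces the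
  recovery sequence.

  For equicoercivity, finite trace means that the quadratic form of \<open>C\<close> is uniformly small on the
  orthogonal complement of a finite system (\<open>covariance_small_off_finite\<close>), and this persists for
  operators close to \<open>C\<close> in norm. Where the form is small its conjugate is large, so points of bounded
  energy lie close to a bounded finite-dimensional set, the same one for all large \<open>n\<close>
  (\<open>conjugate_sublevels_near_compact\<close>). For a single operator the same estimate shows that covariance
  operators are compact, which gives the eigenvector expansion (\<open>covariance_spectral_theorem\<close>) that
  links the conjugate to the square root and the pseudoinverse.
\<close>

section \<open>Orthonormal families\<close>

lemma orthonormal_inner:
  assumes "orthonormal E" "e \<in> E" "f \<in> E"
  shows "e \<bullet> f = (if e = f then 1 else 0)"
proof (cases "e = f")
  case True
  then show ?thesis using assms by (auto simp: orthonormal_def norm_eq_1)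
next
  case False
  then show ?thesis using assms by (auto simp: orthonormal_def pairwise_def orthogonal_def)
qed

lemma orthonormal_subset: "orthonormal E \<Longrightarrow> F \<subseteq> E \<Longrightarrow> orthonormal F"
  unfolding orthonormal_def by (meson pairwise_subset subsetD)

lemma orthonormal_inner_sum:
  assumes "orthonormal E" "finite F" "F \<subseteq> E" "f \<in> E"
  shows "f \<bullet> (\<Sum>e\<in>F. a e *\<^sub>R e) = (if f \<in> F then a f else 0)"
proof -
  have "f \<bullet> (\<Sum>e\<in>F. a e *\<^sub>R e) = (\<Sum>e\<in>F. if f = e then a e else 0)"
    unfolding inner_sum_right
    by (rule sum.cong) (use assms orthonormal_inner[OF assms(1,4)] in auto)
  then show ?thesis using assms(2) by simp
qed

lemma orthonormal_norm_sum:
  assumes "orthonormal F" "finite F"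
  shows "(norm (\<Sum>e\<in>F. a e *\<^sub>R e))\<^sup>2 = (\<Sum>e\<in>F. (a e)\<^sup>2)"
proof -
  have "(norm (\<Sum>e\<in>F. a e *\<^sub>R e))\<^sup>2 = (\<Sum>e\<in>F. a e * (e \<bullet> (\<Sum>e\<in>F. a e *\<^sub>R e)))"
    by (simp add: power2_norm_eq_inner inner_sum_left)
  also have "\<dots> = (\<Sum>e\<in>F. a e * a e)"
    by (rule sum.cong) (use orthonormal_inner_sum[OF assms(1,2) order_refl] in auto)
  finally show ?thesis by (simp add: power2_eq_square)
qed

lemma finite_projection_orthogonal:
  assumes "orthonormal F" "finite F" "f \<in> F"
  shows "f \<bullet> (x - (\<Sum>e\<in>F. (e \<bullet> x) *\<^sub>R e)) = 0"
  using orthonormal_inner_sum[OF assms(1,2) order_refl assms(3)] assms(3)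
  by (simp add: inner_diff_right)

lemma finite_projection_Pythagoras:
  assumes "orthonormal F" "finite F"
  shows "(norm x)\<^sup>2 = (\<Sum>e\<in>F. (e \<bullet> x)\<^sup>2) + (norm (x - (\<Sum>e\<in>F. (e \<bullet> x) *\<^sub>R e)))\<^sup>2"
proof -
  let ?p = "\<Sum>e\<in>F. (e \<bullet> x) *\<^sub>R e"
  have "?p \<bullet> (x - ?p) = 0"
    unfolding inner_sum_left
    by (rule sum.neutral) (use finite_projection_orthogonal[OF assms] in auto)
  then have "(norm (?p + (x - ?p)))\<^sup>2 = (norm ?p)\<^sup>2 + (norm (x - ?p))\<^sup>2"
    by (intro norm_add_Pythagorean) (simp add: orthogonal_def)
  then show ?thesis using orthonormal_norm_sum[OF assms, of "\<lambda>e. e \<bullet> x"] by simp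
qed

lemma Bessel_inequality:
  assumes "orthonormal F" "finite F"
  shows "(\<Sum>e\<in>F. (e \<bullet> x)\<^sup>2) \<le> (norm x)\<^sup>2"
  using finite_projection_Pythagoras[OF assms, of x] by simp

text \<open>The norm of a finite partial sum is the root of the partial sum of the squared coefficients. Hence
  the vector series inherits the Cauchy property from the real series of squares; it need not
  converge absolutely, so the Cauchy filter of partial sums has to be used directly.\<close>
lemma Riesz_Fischer:
  fixes E :: "'a::{real_inner, complete_space} set"
  assumes E: "orthonormal E"
    and bound: "\<And>F. finite F \<Longrightarrow> F \<subseteq> E \<Longrightarrow> (\<Sum>e\<in>F. (a e)\<^sup>2) \<le> B"
  shows "(\<lambda>e. a e *\<^sub>R e) summable_on E"
proof -
  let ?f = "\<lambda>e. a e *\<^sub>R e"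
  have "(\<lambda>e. (a e)\<^sup>2) summable_on E"
    by (rule nonneg_bdd_above_summable_on) (use bound in \<open>auto simp: bdd_above_def\<close>)
  then obtain L where L: "((\<lambda>e. (a e)\<^sup>2) has_sum L) E" by (auto simp: summable_on_def)
  have "\<exists>P. eventually P (finite_subsets_at_top E) \<and>
      (\<forall>F1 F2. P F1 \<and> P F2 \<longrightarrow> dist (sum ?f F1) (sum ?f F2) < r)" if "r > 0" for r
  proof -
    obtain F0 where F0: "finite F0" "F0 \<subseteq> E" "dist (\<Sum>e\<in>F0. (a e)\<^sup>2) L \<le> (r/3)\<^sup>2"
      using has_sum_finite_approximation[OF L, of "(r/3)\<^sup>2"] \<open>r > 0\<close> by auto
    have close: "dist (sum ?f F1) (sum ?f F0) \<le> r/3" if F1: "finite F1" "F1 \<subseteq> E" "F0 \<subseteq> F1" for F1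
    proof -
      have "(dist (sum ?f F1) (sum ?f F0))\<^sup>2 = (norm (sum ?f (F1 - F0)))\<^sup>2"
        using F1 F0 by (simp add: dist_norm sum_diff)
      also have "\<dots> = (\<Sum>e\<in>F1 - F0. (a e)\<^sup>2)"
        by (rule orthonormal_norm_sum) (use F1 E in \<open>auto intro: orthonormal_subset\<close>)
      also have "\<dots> = (\<Sum>e\<in>F1. (a e)\<^sup>2) - (\<Sum>e\<in>F0. (a e)\<^sup>2)"
        using F1 F0 by (simp add: sum_diff)
      also have "\<dots> \<le> L - (\<Sum>e\<in>F0. (a e)\<^sup>2)"
        using finite_sum_le_has_sum[OF L F1(1,2)] by simp
      also have "\<dots> \<le> (r/3)\<^sup>2" using F0(3) by (simp add: dist_real_def)
      finally show ?thesis by (rule power2_le_imp_le) (use \<open>r > 0\<close> in simp)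
    qed
    show ?thesis
    proof (intro exI[of _ "\<lambda>F. finite F \<and> F0 \<subseteq> F \<and> F \<subseteq> E"] conjI allI impI)
      show "\<forall>\<^sub>F F in finite_subsets_at_top E. finite F \<and> F0 \<subseteq> F \<and> F \<subseteq> E"
        unfolding eventually_finite_subsets_at_top using F0 by blast
      fix F1 F2 assume *: "(finite F1 \<and> F0 \<subseteq> F1 \<and> F1 \<subseteq> E) \<and> (finite F2 \<and> F0 \<subseteq> F2 \<and> F2 \<subseteq> E)"
      have "dist (sum ?f F1) (sum ?f F2) \<le> r/3 + r/3"
        using close[of F1] close[of F2] * dist_triangle2[of "sum ?f F1" "sum ?f F2" "sum ?f F0"]
        by linarith
      then show "dist (sum ?f F1) (sum ?f F2) < r" using \<open>r > 0\<close> by simp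
    qed
  qed
  then have "cauchy_filter (filtermap (sum ?f) (finite_subsets_at_top E))"
    by (simp add: cauchy_filter_metric_filtermap)
  then have "convergent_filter (filtermap (sum ?f) (finite_subsets_at_top E))"
    by (rule cauchy_filter_convergent)
  then obtain w where "(sum ?f \<longlongrightarrow> w) (finite_subsets_at_top E)"
    by (auto simp: convergent_filter_iff filterlim_def)
  then show ?thesis
    by (auto simp: summable_on_def has_sum_def)
qed

lemma has_sum_inner:
  assumes "(f has_sum w) E"
  shows "((\<lambda>e. x \<bullet> f e) has_sum (x \<bullet> w)) E"
  using has_sum_bounded_linear[OF bounded_linear_inner_right assms] by simp

lemma orthonormal_coefficient:
  assumes "orthonormal E" "((\<lambda>e. a e *\<^sub>R e) has_sum w) E" "f \<in> E"
  shows "f \<bullet> w = a f"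
proof -
  have "((\<lambda>e. if e = f then a f else 0) has_sum (f \<bullet> w)) E"
    using has_sum_inner[OF assms(2), of f]
    by (rule has_sum_cong[THEN iffD1, rotated])
       (use orthonormal_inner[OF assms(1,3)] in auto)
  moreover have "((\<lambda>e. if e = f then a f else 0) has_sum a f) E"
    by (rule has_sum_finite_neutralI[of "{f}"]) (use assms in auto)
  ultimately show ?thesis using has_sum_unique by blast
qed

lemma orthonormal_Parseval:
  assumes "orthonormal E" "((\<lambda>e. a e *\<^sub>R e) has_sum w) E"
  shows "((\<lambda>e. (a e)\<^sup>2) has_sum (norm w)\<^sup>2) E"
proof -
  have "((\<lambda>e. w \<bullet> (a e *\<^sub>R e)) has_sum (w \<bullet> w)) E"
    by (rule has_sum_inner[OF assms(2)])
  then show ?thesis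
    unfolding power2_norm_eq_inner
    by (rule has_sum_cong[THEN iffD1, rotated])
       (use orthonormal_coefficient[OF assms] in \<open>auto simp: inner_commute power2_eq_square\<close>)
qed

lemma orthogonal_has_sum:
  assumes "((\<lambda>e. a e *\<^sub>R e) has_sum w) E" "\<And>e. e \<in> E \<Longrightarrow> e \<bullet> r = 0"
  shows "r \<bullet> w = 0"
proof -
  have "((\<lambda>e. 0) has_sum (r \<bullet> w)) E"
    using has_sum_inner[OF assms(1), of r]
    by (rule has_sum_cong[THEN iffD1, rotated]) (use assms(2) in \<open>auto simp: inner_commute\<close>)
  then show ?thesis using has_sum_unique has_sum_0_simp by blast
qed

lemma Fourier_summable:
  fixes x :: "'a::{real_inner, complete_space}"
  assumes "orthonormal E"
  shows "(\<lambda>e. (e \<bullet> x) *\<^sub>R e) summable_on E"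
  using assms
  by (rule Riesz_Fischer) (use assms Bessel_inequality orthonormal_subset in blast)

section \<open>Mean and covariance are determined by the measure\<close>

lemma covariance_sym:
  assumes "covariance_operator C"
  shows "blinfun_apply C x \<bullet> y = x \<bullet> blinfun_apply C y"
  using assms by (auto simp: covariance_operator_def self_adjoint_def)

lemma covariance_nonneg:
  assumes "covariance_operator C"
  shows "0 \<le> x \<bullet> blinfun_apply C x"
  using assms by (auto simp: covariance_operator_def positive_semidefinite_def)

lemma covariance_quadratic_add:
  assumes "covariance_operator C"
  shows "(x + s *\<^sub>R y) \<bullet> blinfun_apply C (x + s *\<^sub>R y)
    = x \<bullet> blinfun_apply C x + 2 * s * (y \<bullet> blinfun_apply C x) + s\<^sup>2 * (y \<bullet> blinfun_apply C y)"
proof -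
  have "x \<bullet> blinfun_apply C y = y \<bullet> blinfun_apply C x"
    using covariance_sym[OF assms, of x y] by (simp add: inner_commute)
  then show ?thesis
    by (simp add: blinfun.add_right blinfun.scaleR_right inner_add_left inner_add_right
        power2_eq_square algebra_simps)
qed

text \<open>Equality of the phases of two characteristic functionals fixes \<open>h \<bullet> m\<close> only modulo \<open>2\<pi>\<close>. Scaling \<open>h\<close>
  by all reals removes the ambiguity: otherwise some multiple would have phase \<open>\<pi>\<close>.\<close>
lemma real_all_exp_eq_1_imp_zero:
  fixes b :: real
  assumes "\<And>t::real. exp (\<i> * complex_of_real (t * b)) = 1"
  shows "b = 0"
proof (rule ccontr)
  assume "b \<noteq> 0"
  have "exp (\<i> * complex_of_real pi) = 1"
    using assms[of "pi / b"] \<open>b \<noteq> 0\<close> by simp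
  then show False by simp
qed

text \<open>The modulus of the characteristic functional gives the quadratic form of the covariance, hence by
  polarisation the covariance itself; its phase then gives the mean. This makes both definite
  descriptions in the definition of the Onsager--Machlup functional meaningful.\<close>
lemma gaussian_measure_unique:
  assumes 1: "gaussian_measure M m C" and 2: "gaussian_measure M m' C'"
  shows "m = m' \<and> C = C'"
proof -
  have eq: "exp (\<i> * complex_of_real (h \<bullet> m) - complex_of_real (h \<bullet> blinfun_apply C h) / 2)
      = exp (\<i> * complex_of_real (h \<bullet> m') - complex_of_real (h \<bullet> blinfun_apply C' h) / 2)" for h
    using 1 2 by (simp add: gaussian_measure_def)
  have C: "covariance_operator C" and C': "covariance_operator C'"
    using 1 2 by (auto simp: gaussian_measure_def)
  have quad: "h \<bullet> blinfun_apply C h = h \<bullet> blinfun_apply C' h" for h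
    using arg_cong[OF eq[of h], of norm] by simp
  have polar: "y \<bullet> blinfun_apply C x = y \<bullet> blinfun_apply C' x" for x y
    using quad[of "x + 1 *\<^sub>R y"] quad[of x] quad[of y]
    unfolding covariance_quadratic_add[OF C] covariance_quadratic_add[OF C'] by simp
  have "C = C'"
    by (rule blinfun_eqI) (metis polar vector_eq_rdot inner_commute)
  moreover have "m = m'"
  proof -
    define d where "d = m - m'"
    have "exp (\<i> * complex_of_real (t * (d \<bullet> d))) = 1" for t
    proof -
      have "exp (\<i> * complex_of_real ((t *\<^sub>R d) \<bullet> m)) = exp (\<i> * complex_of_real ((t *\<^sub>R d) \<bullet> m'))"
        using eq[of "t *\<^sub>R d"] unfolding quad[of "t *\<^sub>R d"] exp_diff by simp
      then have "exp (\<i> * complex_of_real ((t *\<^sub>R d) \<bullet> m) - \<i> * complex_of_real ((t *\<^sub>R d) \<bullet> m')) = 1"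
        by (simp add: exp_diff)
      moreover have "\<i> * complex_of_real ((t *\<^sub>R d) \<bullet> m) - \<i> * complex_of_real ((t *\<^sub>R d) \<bullet> m')
          = \<i> * complex_of_real (t * (d \<bullet> d))"
        by (simp add: d_def inner_diff_right inner_diff_left algebra_simps)
      ultimately show ?thesis by simp
    qed
    then have "d \<bullet> d = 0" by (rule real_all_exp_eq_1_imp_zero)
    then show ?thesis by (simp add: d_def)
  qed
  ultimately show ?thesis by simp
qed

lemma gaussian_mean_eq: "gaussian_measure M m C \<Longrightarrow> gaussian_mean M = m"
  unfolding gaussian_mean_def by (rule the_equality) (use gaussian_measure_unique in blast)+

lemma gaussian_cov_eq: "gaussian_measure M m C \<Longrightarrow> gaussian_cov M = C"
  unfolding gaussian_cov_def by (rule the_equality) (use gaussian_measure_unique in blast)+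

section \<open>Compactness from the finite trace\<close>

text \<open>The sublevel set \<open>{J \<le> t}\<close> of the convex conjugate \<open>J v = (SUP h. h \<bullet> v - (h \<bullet> C h) / 2)\<close> of the
  quadratic form of \<open>C\<close>. Working with sublevel sets keeps the argument in the reals, although \<open>J\<close>
  may be infinite.\<close>
definition conjugate_sublevel :: "('a::real_inner \<Rightarrow>\<^sub>L 'a) \<Rightarrow> real \<Rightarrow> 'a set" where
  "conjugate_sublevel C t = {v. \<forall>h. h \<bullet> v - (h \<bullet> blinfun_apply C h) / 2 \<le> t}"

text \<open>The form \<open>y \<bullet> C x\<close> is a possibly degenerate inner product.\<close>
lemma covariance_Cauchy_Schwarz:
  assumes C: "covariance_operator C"
  shows "(y \<bullet> blinfun_apply C x)\<^sup>2 \<le> (x \<bullet> blinfun_apply C x) * (y \<bullet> blinfun_apply C y)"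
proof -
  define a b c where "a = y \<bullet> blinfun_apply C y" and "b = y \<bullet> blinfun_apply C x"
    and "c = x \<bullet> blinfun_apply C x"
  have pos: "0 \<le> c + 2 * s * b + s\<^sup>2 * a" for s
    using covariance_nonneg[OF C, of "x + s *\<^sub>R y"]
    unfolding covariance_quadratic_add[OF C] a_def b_def c_def .
  have "b\<^sup>2 \<le> c * a"
  proof (cases "a = 0")
    case True
    have "b = 0"
    proof (rule ccontr)
      assume "b \<noteq> 0"
      then show False
        using pos[of "- (c + 1) / b"] True covariance_nonneg[OF C, of x] by (simp add: c_def)
    qed
    then show ?thesis using True by simp
  next
    case False
    then have "a > 0" using covariance_nonneg[OF C, of y] by (simp add: a_def)
    have "c + 2 * (- b / a) * b + (- b / a)\<^sup>2 * a = c - b\<^sup>2 / a"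
      using \<open>a > 0\<close> by (simp add: field_simps power2_eq_square)
    then have "b\<^sup>2 / a \<le> c" using pos[of "- b / a"] by linarith
    then show ?thesis using \<open>a > 0\<close> by (simp add: field_simps)
  qed
  then show ?thesis by (simp add: a_def b_def c_def)
qed

lemma blinfun_quadratic_le_norm:
  "h \<bullet> blinfun_apply C h \<le> norm C * (norm h)\<^sup>2"
proof -
  have "h \<bullet> blinfun_apply C h \<le> norm h * norm (blinfun_apply C h)"
    by (rule norm_cauchy_schwarz)
  also have "\<dots> \<le> norm h * (norm C * norm h)"
    by (intro mult_left_mono norm_blinfun) simp
  finally show ?thesis by (simp add: power2_eq_square mult_ac)
qed

text \<open>This is where finiteness of the trace enters. Take \<open>F\<close> to be a finite part of the basis that carries
  all but \<open>\<delta>\<close> of the trace. For a finite combination \<open>x\<close> of the remaining basis vectors, the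
  Cauchy--Schwarz inequalities for sums and for the form of \<open>C\<close> bound \<open>x \<bullet> C x\<close> by the remaining trace
  times \<open>(norm x)\<^sup>2\<close>. A general \<open>h\<close> orthogonal to \<open>F\<close> is a limit of such \<open>x\<close>: approximate it in the
  span of the basis and subtract the components along \<open>F\<close>.\<close>
lemma covariance_small_off_finite:
  assumes C: "covariance_operator C" and "\<delta> > 0"
  obtains F where "finite F" "orthonormal F"
    "\<And>h. (\<And>e. e \<in> F \<Longrightarrow> e \<bullet> h = 0) \<Longrightarrow> h \<bullet> blinfun_apply C h \<le> \<delta> * (norm h)\<^sup>2"
proof -
  obtain B S where B: "orthonormal B" "closure (span B) = UNIV"
    and S: "((\<lambda>e. e \<bullet> blinfun_apply C e) has_sum S) B"
    using C by (auto simp: covariance_operator_def finite_trace_def orthonormal_basis_def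
        summable_on_def)
  obtain F where F: "finite F" "F \<subseteq> B" "dist (\<Sum>e\<in>F. e \<bullet> blinfun_apply C e) S \<le> \<delta>"
    using has_sum_finite_approximation[OF S \<open>\<delta> > 0\<close>] by auto
  have tail: "(\<Sum>e\<in>G. e \<bullet> blinfun_apply C e) \<le> \<delta>" if G: "finite G" "G \<subseteq> B - F" for G
  proof -
    have "(\<Sum>e\<in>F \<union> G. e \<bullet> blinfun_apply C e) \<le> S"
      by (rule finite_sum_le_has_sum[OF S]) (use F G covariance_nonneg[OF C] in auto)
    moreover have "(\<Sum>e\<in>F \<union> G. e \<bullet> blinfun_apply C e)
        = (\<Sum>e\<in>F. e \<bullet> blinfun_apply C e) + (\<Sum>e\<in>G. e \<bullet> blinfun_apply C e)"
      by (rule sum.union_disjoint) (use F G in auto)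
    ultimately show ?thesis using F(3) by (simp add: dist_real_def)
  qed
  have span: "x \<bullet> blinfun_apply C x \<le> \<delta> * (norm x)\<^sup>2"
    if G: "finite G" "G \<subseteq> B - F" and x: "x = (\<Sum>e\<in>G. a e *\<^sub>R e)" for G a x
  proof -
    define q where "q = x \<bullet> blinfun_apply C x"
    have "q \<ge> 0" unfolding q_def by (rule covariance_nonneg[OF C])
    have ortho: "orthonormal G" using G B orthonormal_subset by blast
    have "q = (\<Sum>e\<in>G. a e * (e \<bullet> blinfun_apply C x))"
      unfolding q_def by (subst x) (simp add: inner_sum_left)
    then have "q\<^sup>2 \<le> (\<Sum>e\<in>G. (a e)\<^sup>2) * (\<Sum>e\<in>G. (e \<bullet> blinfun_apply C x)\<^sup>2)"
      by (simp add: Cauchy_Schwarz_ineq_sum)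
    also have "\<dots> \<le> (norm x)\<^sup>2 * (\<Sum>e\<in>G. q * (e \<bullet> blinfun_apply C e))"
    proof (intro mult_mono sum_mono sum_nonneg)
      show "(\<Sum>e\<in>G. (a e)\<^sup>2) \<le> (norm x)\<^sup>2"
        unfolding x orthonormal_norm_sum[OF ortho G(1)] ..
      show "(e \<bullet> blinfun_apply C x)\<^sup>2 \<le> q * (e \<bullet> blinfun_apply C e)" for e
        unfolding q_def by (rule covariance_Cauchy_Schwarz[OF C])
    qed auto
    also have "\<dots> \<le> (norm x)\<^sup>2 * (q * \<delta>)"
      unfolding sum_distrib_left[symmetric]
      by (intro mult_left_mono tail G \<open>q \<ge> 0\<close>) simp
    finally have "q * q \<le> q * (\<delta> * (norm x)\<^sup>2)" by (simp add: power2_eq_square mult_ac)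
    then show ?thesis using \<open>q \<ge> 0\<close> \<open>\<delta> > 0\<close> unfolding q_def[symmetric]
      by (cases "q = 0") (auto simp: mult_le_cancel_left)
  qed
  have "h \<bullet> blinfun_apply C h \<le> \<delta> * (norm h)\<^sup>2" if h: "\<And>e. e \<in> F \<Longrightarrow> e \<bullet> h = 0" for h
  proof -
    obtain x where x: "\<And>n. x n \<in> span B" "x \<longlonglongrightarrow> h"
      using B(2) by (metis UNIV_I closure_sequential)
    define y where "y n = x n - (\<Sum>e\<in>F. (e \<bullet> x n) *\<^sub>R e)" for n
    have "y \<longlonglongrightarrow> h - (\<Sum>e\<in>F. (e \<bullet> h) *\<^sub>R e)"
      unfolding y_def by (intro tendsto_intros x)
    then have y: "y \<longlonglongrightarrow> h" using h by simp
    have "y n \<bullet> blinfun_apply C (y n) \<le> \<delta> * (norm (y n))\<^sup>2" for n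
    proof -
      obtain G a where G: "finite G" "G \<subseteq> B" "x n = (\<Sum>e\<in>G. a e *\<^sub>R e)"
        using x(1)[of n] unfolding span_explicit by auto
      have coeff: "e \<bullet> x n = (if e \<in> G then a e else 0)" if "e \<in> B" for e
        unfolding G(3) by (rule orthonormal_inner_sum[OF B(1) G(1,2) that])
      have "x n = (\<Sum>e\<in>G. (e \<bullet> x n) *\<^sub>R e)"
        unfolding G(3) by (rule sum.cong) (use coeff G in auto)
      also have "\<dots> = (\<Sum>e\<in>G \<union> F. (e \<bullet> x n) *\<^sub>R e)"
        by (rule sum.mono_neutral_left) (use G F coeff in auto)
      also have "\<dots> = (\<Sum>e\<in>F. (e \<bullet> x n) *\<^sub>R e) + (\<Sum>e\<in>G - F. (e \<bullet> x n) *\<^sub>R e)"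
        by (subst sum.union_disjoint[symmetric]) (use G F in \<open>auto intro: sum.cong\<close>)
      finally have "y n = (\<Sum>e\<in>G - F. (e \<bullet> x n) *\<^sub>R e)"
        unfolding y_def by (metis add_diff_cancel_left')
      then show ?thesis by (intro span[of "G - F"]) (use G in auto)
    qed
    moreover have "(\<lambda>n. y n \<bullet> blinfun_apply C (y n)) \<longlonglongrightarrow> h \<bullet> blinfun_apply C h"
      by (intro tendsto_intros y)
    moreover have "(\<lambda>n. \<delta> * (norm (y n))\<^sup>2) \<longlonglongrightarrow> \<delta> * (norm h)\<^sup>2"
      by (intro tendsto_intros y)
    ultimately show ?thesis by (meson LIMSEQ_le)
  qed
  with F B show ?thesis using that[of F] orthonormal_subset by blast
qed

lemma compact_coefficient_box:
  fixes F :: "'a::real_normed_vector set"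
  assumes "finite F"
  shows "compact {\<Sum>e\<in>F. a e *\<^sub>R e | a. \<forall>e\<in>F. \<bar>a e\<bar> \<le> R}"
  using assms
proof (induction F)
  case empty
  then show ?case by simp
next
  case (insert f F)
  have "compact ((\<lambda>r::real. r *\<^sub>R f) ` {-R..R})"
    by (intro compact_continuous_image continuous_intros) simp
  from compact_sums[OF this insert.IH]
  have "compact {x + y |x y. x \<in> (\<lambda>r. r *\<^sub>R f) ` {-R..R} \<and>
      y \<in> {\<Sum>e\<in>F. a e *\<^sub>R e | a. \<forall>e\<in>F. \<bar>a e\<bar> \<le> R}}" .
  moreover have "{x + y |x y. x \<in> (\<lambda>r. r *\<^sub>R f) ` {-R..R} \<and>
      y \<in> {\<Sum>e\<in>F. a e *\<^sub>R e | a. \<forall>e\<in>F. \<bar>a e\<bar> \<le> R}}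
    = {\<Sum>e\<in>insert f F. a e *\<^sub>R e | a. \<forall>e\<in>insert f F. \<bar>a e\<bar> \<le> R}" (is "?L = ?R")
  proof (intro equalityI subsetI)
    fix z assume "z \<in> ?L"
    then obtain r a where "r \<in> {-R..R}" and r: "\<forall>e\<in>F. \<bar>a e\<bar> \<le> R" "z = r *\<^sub>R f + (\<Sum>e\<in>F. a e *\<^sub>R e)"
      by blast
    then have "\<bar>r\<bar> \<le> R" by (simp add: abs_le_iff)
    have "(\<Sum>e\<in>F. (a(f := r)) e *\<^sub>R e) = (\<Sum>e\<in>F. a e *\<^sub>R e)"
      by (rule sum.cong) (use insert.hyps in auto)
    then have "z = (\<Sum>e\<in>insert f F. (a(f := r)) e *\<^sub>R e)" using insert.hyps r by simp
    then show "z \<in> ?R" using r \<open>\<bar>r\<bar> \<le> R\<close> by (intro CollectI exI[of _ "a(f := r)"]) auto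
  next
    fix z assume "z \<in> ?R"
    then obtain a where "\<forall>e\<in>insert f F. \<bar>a e\<bar> \<le> R" "z = (\<Sum>e\<in>insert f F. a e *\<^sub>R e)" by auto
    then show "z \<in> ?L" using insert.hyps
      by (intro CollectI exI[of _ "a f *\<^sub>R f"] exI[of _ "\<Sum>e\<in>F. a e *\<^sub>R e"])
         (auto simp: abs_le_iff)
  qed
  ultimately show ?case by simp
qed

text \<open>Testing the defining inequality with \<open>h = k / \<delta>\<close>, the maximiser of \<open>s * k \<bullet> v - s\<^sup>2 * \<delta> * (norm k)\<^sup>2 / 2\<close>
  over multiples \<open>s * k\<close>, gives the bound. It is used for \<open>k = v\<close> and for the part \<open>k\<close> of \<open>v\<close> orthogonal
  to a finite system.\<close>
lemma conjugate_sublevel_component_bound: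
  assumes v: "v \<in> conjugate_sublevel C t" and k: "k \<bullet> v = (norm k)\<^sup>2"
    and \<delta>: "k \<bullet> blinfun_apply C k \<le> \<delta> * (norm k)\<^sup>2" "\<delta> > 0"
  shows "(norm k)\<^sup>2 \<le> 2 * t * \<delta>"
proof -
  have "(inverse \<delta> *\<^sub>R k) \<bullet> v - ((inverse \<delta> *\<^sub>R k) \<bullet> blinfun_apply C (inverse \<delta> *\<^sub>R k)) / 2 \<le> t"
    using v unfolding conjugate_sublevel_def by blast
  then have "inverse \<delta> * (norm k)\<^sup>2 - (inverse \<delta>)\<^sup>2 * (k \<bullet> blinfun_apply C k) / 2 \<le> t"
    by (simp only: k blinfun.scaleR_right inner_scaleR_left inner_scaleR_right
        power2_eq_square mult.assoc)
  moreover have "(inverse \<delta>)\<^sup>2 * (k \<bullet> blinfun_apply C k) \<le> (inverse \<delta>)\<^sup>2 * (\<delta> * (norm k)\<^sup>2)"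
    by (intro mult_left_mono \<delta>) simp
  moreover have "(inverse \<delta>)\<^sup>2 * (\<delta> * (norm k)\<^sup>2) = inverse \<delta> * (norm k)\<^sup>2"
    using \<delta>(2) by (simp add: power2_eq_square)
  ultimately have "inverse \<delta> * (norm k)\<^sup>2 \<le> 2 * t" by linarith
  then show ?thesis using \<delta>(2) by (simp add: field_simps)
qed

text \<open>Where the quadratic form is small, its conjugate is large, so the part of \<open>v\<close> orthogonal to \<open>F\<close> has
  norm below \<open>\<epsilon>\<close>; the remaining part lies in a bounded subset of the span of \<open>F\<close>.\<close>
lemma conjugate_sublevel_near_box:
  assumes F: "finite F" "orthonormal F"
    and small: "\<And>h. (\<And>e. e \<in> F \<Longrightarrow> e \<bullet> h = 0) \<Longrightarrow> h \<bullet> blinfun_apply C h \<le> \<delta> * (norm h)\<^sup>2"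
    and \<delta>: "\<delta> > 0" "2 * t * \<delta> < \<epsilon>\<^sup>2" and "\<epsilon> > 0" and M: "norm C \<le> M" "M > 0"
    and v: "v \<in> conjugate_sublevel C t"
  shows "\<exists>y\<in>{\<Sum>e\<in>F. a e *\<^sub>R e | a. \<forall>e\<in>F. \<bar>a e\<bar> \<le> 2 * t * M + 1}. dist v y < \<epsilon>"
proof -
  define p where "p = (\<Sum>e\<in>F. (e \<bullet> v) *\<^sub>R e)"
  have orth: "e \<bullet> (v - p) = 0" if "e \<in> F" for e
    unfolding p_def by (rule finite_projection_orthogonal[OF F(2,1) that])
  have "(v - p) \<bullet> p = 0"
    unfolding p_def inner_sum_right by (rule sum.neutral) (use orth in \<open>auto simp: p_def inner_commute\<close>)
  then have "(v - p) \<bullet> v = (norm (v - p))\<^sup>2"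
    by (simp add: power2_norm_eq_inner inner_diff_right)
  then have "(norm (v - p))\<^sup>2 \<le> 2 * t * \<delta>"
    using small[OF orth] \<delta>(1) by (rule conjugate_sublevel_component_bound[OF v])
  then have "(norm (v - p))\<^sup>2 < \<epsilon>\<^sup>2" using \<delta>(2) by linarith
  then have "dist v p < \<epsilon>" using \<open>\<epsilon> > 0\<close> by (simp add: dist_norm power2_less_imp_less)
  moreover have "\<bar>e \<bullet> v\<bar> \<le> 2 * t * M + 1" if "e \<in> F" for e
  proof -
    have "v \<bullet> blinfun_apply C v \<le> M * (norm v)\<^sup>2"
      using blinfun_quadratic_le_norm[of v C] mult_right_mono[OF M(1), of "(norm v)\<^sup>2"] by simp
    then have "(norm v)\<^sup>2 \<le> 2 * t * M"
      using M(2) by (intro conjugate_sublevel_component_bound[OF v]) (auto simp: power2_norm_eq_inner)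
    \<comment> \<open>A crude bound that replaces the square root of \<open>2 * t * M\<close> in the size of the box.\<close>
    moreover have "norm v \<le> (norm v)\<^sup>2 + 1"
      using zero_le_power2[of "norm v - 1"] norm_ge_zero[of v]
      unfolding power2_diff by (simp only: power_one mult_1_right)
    moreover have "\<bar>e \<bullet> v\<bar> \<le> norm v"
      using Cauchy_Schwarz_ineq2[of e v] F(2) that by (simp add: orthonormal_def)
    ultimately show ?thesis by linarith
  qed
  ultimately show ?thesis
    by (intro bexI[of _ p]) (auto simp: p_def)
qed

text \<open>Total boundedness passes from the compact approximations to \<open>S\<close>, and completeness turns it into
  relative compactness.\<close>
lemma compact_closure_if_near_compact:
  fixes S :: "'a::complete_space set"
  assumes near: "\<And>\<epsilon>. \<epsilon> > 0 \<Longrightarrow> \<exists>K. compact K \<and> (\<forall>x\<in>S. \<exists>y\<in>K. dist x y < \<epsilon>)"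
  shows "compact (closure S)"
  unfolding compact_eq_totally_bounded
proof (intro conjI allI impI)
  show "uniform_space_class.complete (closure S)" by (simp add: complete_eq_closed)
next
  fix \<epsilon> :: real assume "\<epsilon> > 0"
  then obtain K where K: "compact K" "\<And>x. x \<in> S \<Longrightarrow> \<exists>y\<in>K. dist x y < \<epsilon>/3"
    using near[of "\<epsilon>/3"] by auto
  obtain k where k: "finite k" "K \<subseteq> (\<Union>x\<in>k. ball x (\<epsilon>/3))"
    using K(1) \<open>\<epsilon> > 0\<close> unfolding compact_eq_totally_bounded by (meson divide_pos_pos zero_less_numeral)
  have "closure S \<subseteq> (\<Union>x\<in>k. ball x \<epsilon>)"
  proof
    fix x assume "x \<in> closure S"
    then obtain s where s: "s \<in> S" "dist s x < \<epsilon>/3"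
      using \<open>\<epsilon> > 0\<close> by (metis closure_approachable divide_pos_pos zero_less_numeral)
    obtain y where y: "y \<in> K" "dist s y < \<epsilon>/3" using K(2)[OF s(1)] by auto
    obtain z where z: "z \<in> k" "dist z y < \<epsilon>/3" using k(2) y(1) by auto
    have "dist z x < \<epsilon>"
      using s(2) y(2) z(2) dist_triangle[of z x y] dist_triangle[of y x s] dist_commute[of y s] by linarith
    then show "x \<in> (\<Union>x\<in>k. ball x \<epsilon>)" using z(1) by auto
  qed
  then show "\<exists>k. finite k \<and> closure S \<subseteq> (\<Union>x\<in>k. ball x \<epsilon>)" using k(1) by blast
qed

text \<open>A finite system that captures \<open>C\<close> up to \<open>\<delta> / 2\<close> captures every \<open>C\<^sub>n\<close> with \<open>norm (C\<^sub>n - C) < \<delta> / 2\<close> up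
  to \<open>\<delta>\<close>, so one compact set serves all large \<open>n\<close>. The finitely many remaining operators are captured
  one at a time. This uniformity in \<open>n\<close> is what yields equicoercivity.\<close>
lemma conjugate_sublevels_near_compact:
  fixes Cs :: "nat \<Rightarrow> ('a::real_inner \<Rightarrow>\<^sub>L 'a)"
  assumes C: "covariance_operator C" and Cs: "\<And>n. covariance_operator (Cs n)"
    and lim: "Cs \<longlonglongrightarrow> C" and "\<epsilon> > 0"
  shows "\<exists>K. compact K \<and> (\<forall>n. \<forall>v\<in>conjugate_sublevel (Cs n) t. \<exists>y\<in>K. dist v y < \<epsilon>)"
proof -
  define \<delta> where "\<delta> = \<epsilon>\<^sup>2 / (2 * (\<bar>t\<bar> + 1))"
  have "\<delta> > 0" using \<open>\<epsilon> > 0\<close> by (simp add: \<delta>_def)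
  have "2 * t * \<delta> < 2 * (\<bar>t\<bar> + 1) * \<delta>" using \<open>\<delta> > 0\<close> by (intro mult_strict_right_mono) auto
  then have \<delta>: "2 * t * \<delta> < \<epsilon>\<^sup>2" by (simp add: \<delta>_def)
  obtain F where F: "finite F" "orthonormal F"
    "\<And>h. (\<And>e. e \<in> F \<Longrightarrow> e \<bullet> h = 0) \<Longrightarrow> h \<bullet> blinfun_apply C h \<le> \<delta>/2 * (norm h)\<^sup>2"
    using covariance_small_off_finite[OF C, of "\<delta>/2"] \<open>\<delta> > 0\<close> by auto
  have "\<forall>n. \<exists>F. finite F \<and> orthonormal F \<and>
      (\<forall>h. (\<forall>e\<in>F. e \<bullet> h = 0) \<longrightarrow> h \<bullet> blinfun_apply (Cs n) h \<le> \<delta> * (norm h)\<^sup>2)"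
    using covariance_small_off_finite[OF Cs \<open>\<delta> > 0\<close>] by metis
  then obtain G where G: "\<And>n. finite (G n)" "\<And>n. orthonormal (G n)"
    "\<And>n h. (\<And>e. e \<in> G n \<Longrightarrow> e \<bullet> h = 0) \<Longrightarrow> h \<bullet> blinfun_apply (Cs n) h \<le> \<delta> * (norm h)\<^sup>2"
    by metis
  obtain N where N: "\<And>n. n \<ge> N \<Longrightarrow> norm (Cs n - C) < min (\<delta>/2) 1"
    using LIMSEQ_D[OF lim, of "min (\<delta>/2) 1"] \<open>\<delta> > 0\<close> by auto
  define box where "box F M = {\<Sum>e\<in>F. a e *\<^sub>R e | a. \<forall>e\<in>F. \<bar>a e\<bar> \<le> 2 * t * M + 1}" for F :: "'a set" and M
  define K where "K = box F (norm C + 1) \<union> (\<Union>n<N. box (G n) (norm (Cs n) + 1))"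
  have "compact K"
    unfolding K_def box_def
    by (intro compact_Un compact_UN compact_coefficient_box F G finite_lessThan ballI)
  moreover have "\<exists>y\<in>K. dist v y < \<epsilon>" if v: "v \<in> conjugate_sublevel (Cs n) t" for n v
  proof (cases "n < N")
    case True
    have "\<exists>y\<in>box (G n) (norm (Cs n) + 1). dist v y < \<epsilon>"
      unfolding box_def
      by (rule conjugate_sublevel_near_box[OF G(1,2) G(3) \<open>\<delta> > 0\<close> \<delta> \<open>\<epsilon> > 0\<close> _ _ v])
         (auto intro: add_nonneg_pos)
    then show ?thesis using True by (auto simp: K_def)
  next
    case False
    then have close: "norm (Cs n - C) < \<delta>/2" "norm (Cs n - C) < 1" using N[of n] by auto
    have "h \<bullet> blinfun_apply (Cs n) h \<le> \<delta> * (norm h)\<^sup>2" if "\<And>e. e \<in> F \<Longrightarrow> e \<bullet> h = 0" for h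
    proof -
      have "h \<bullet> blinfun_apply (Cs n - C) h \<le> \<delta>/2 * (norm h)\<^sup>2"
        using blinfun_quadratic_le_norm[of h "Cs n - C"]
          mult_right_mono[of "norm (Cs n - C)" "\<delta>/2" "(norm h)\<^sup>2"] close(1) by simp
      then show ?thesis using F(3)[OF that] by (simp add: blinfun.diff_left inner_diff_right)
    qed
    moreover have "norm (Cs n) \<le> norm C + 1"
      using close(2) norm_triangle_ineq2[of "Cs n" C] by linarith
    ultimately have "\<exists>y\<in>box F (norm C + 1). dist v y < \<epsilon>"
      unfolding box_def
      by (intro conjugate_sublevel_near_box[OF F(1,2) _ \<open>\<delta> > 0\<close> \<delta> \<open>\<epsilon> > 0\<close> _ _ v])
         (auto intro: add_nonneg_pos)
    then show ?thesis by (auto simp: K_def)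
  qed
  ultimately show ?thesis by blast
qed

text \<open>Expand \<open>0 \<le> (x - h) \<bullet> C (x - h)\<close>. In other words, the conjugate at \<open>C x\<close> is at most \<open>(x \<bullet> C x) / 2\<close>,
  which supplies competitors of controlled energy.\<close>
lemma covariance_image_in_conjugate_sublevel:
  assumes C: "covariance_operator C"
  shows "blinfun_apply C x \<in> conjugate_sublevel C ((x \<bullet> blinfun_apply C x) / 2)"
  unfolding conjugate_sublevel_def
proof (intro CollectI allI)
  fix h
  show "h \<bullet> blinfun_apply C x - (h \<bullet> blinfun_apply C h) / 2 \<le> (x \<bullet> blinfun_apply C x) / 2"
    using covariance_nonneg[OF C, of "x + (-1) *\<^sub>R h"]
    unfolding covariance_quadratic_add[OF C] by simp
qed

lemma conjugate_sublevel_mono: "s \<le> t \<Longrightarrow> conjugate_sublevel C s \<subseteq> conjugate_sublevel C t"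
  unfolding conjugate_sublevel_def by (blast intro: order_trans)

text \<open>The image of the unit ball lies in a single conjugate sublevel set, and these are totally bounded.\<close>
lemma covariance_operator_compact:
  fixes C :: "'a::{real_inner, complete_space} \<Rightarrow>\<^sub>L 'a"
  assumes C: "covariance_operator C"
  shows "compact (closure (blinfun_apply C ` cball 0 1))"
proof (rule compact_closure_if_near_compact)
  fix \<epsilon> :: real assume "\<epsilon> > 0"
  have "blinfun_apply C x \<in> conjugate_sublevel C (norm C / 2)" if "norm x \<le> 1" for x
  proof -
    have "x \<bullet> blinfun_apply C x \<le> norm C * (norm x)\<^sup>2" by (rule blinfun_quadratic_le_norm)
    also have "\<dots> \<le> norm C * 1"
      using that by (intro mult_left_mono) (auto simp: power_le_one)
    finally show ?thesis
      using covariance_image_in_conjugate_sublevel[OF C, of x]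
        conjugate_sublevel_mono[of "(x \<bullet> blinfun_apply C x) / 2" "norm C / 2" C] by auto
  qed
  then show "\<exists>K. compact K \<and> (\<forall>x\<in>blinfun_apply C ` cball 0 1. \<exists>y\<in>K. dist x y < \<epsilon>)"
    using conjugate_sublevels_near_compact[OF C C tendsto_const \<open>\<epsilon> > 0\<close>, of "norm C / 2"]
    by (auto simp: dist_norm)
qed

section \<open>The spectral theorem\<close>

text \<open>Maximise the Rayleigh quotient on the unit sphere of \<open>V\<close>. The Cauchy--Schwarz inequality for the
  form of \<open>C\<close> gives \<open>(norm (C x))\<^sup>2 \<le> \<kappa> * (x \<bullet> C x)\<close> on \<open>V\<close>, where \<open>\<kappa>\<close> is the supremum, so
  \<open>C x\<^sub>n - \<kappa> *\<^sub>R x\<^sub>n\<close> tends to \<open>0\<close> along a maximising sequence. By compactness \<open>C x\<^sub>n\<close> converges along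
  a subsequence, and therefore so does \<open>x\<^sub>n\<close>, to an eigenvector.\<close>
lemma covariance_eigenvector_exists:
  fixes C :: "'a::{real_inner, complete_space} \<Rightarrow>\<^sub>L 'a"
  assumes C: "covariance_operator C"
    and V: "subspace V" "closed V" "\<And>x. x \<in> V \<Longrightarrow> blinfun_apply C x \<in> V"
    and x0: "x0 \<in> V" "x0 \<bullet> blinfun_apply C x0 > 0"
  obtains e \<kappa> where "e \<in> V" "norm e = 1" "\<kappa> > 0" "blinfun_apply C e = \<kappa> *\<^sub>R e"
proof -
  define q where "q x = x \<bullet> blinfun_apply C x" for x
  define U where "U = {x \<in> V. norm x = 1}"
  define \<kappa> where "\<kappa> = Sup (q ` U)"
  have bdd: "bdd_above (q ` U)"
  proof (rule bdd_aboveI2)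
    fix x assume "x \<in> U"
    then show "q x \<le> norm C"
      using blinfun_quadratic_le_norm[of x C] by (simp add: U_def q_def)
  qed
  have scale: "q (s *\<^sub>R x) = s\<^sup>2 * q x" for s x
    by (simp add: q_def blinfun.scaleR_right power2_eq_square)
  have unit: "sgn x \<in> U" if "x \<in> V" "x \<noteq> 0" for x
    using that V(1) by (simp add: U_def sgn_div_norm subspace_scale)
  have q_le: "q x \<le> \<kappa> * (norm x)\<^sup>2" if "x \<in> V" for x
  proof (cases "x = 0")
    case False
    have "q (sgn x) \<le> \<kappa>"
      unfolding \<kappa>_def by (rule cSUP_upper[OF unit[OF that False] bdd])
    then have "(norm x)\<^sup>2 * q (sgn x) \<le> (norm x)\<^sup>2 * \<kappa>" by (intro mult_left_mono) auto
    moreover have "(norm x)\<^sup>2 * q (sgn x) = q x"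
      using scale[of "norm x" "sgn x"] False by (simp add: sgn_div_norm)
    ultimately show ?thesis by (simp add: mult.commute)
  qed (simp add: q_def)
  have "x0 \<noteq> 0" using x0(2) by auto
  then have "\<kappa> > 0"
    using q_le[OF x0(1)] x0(2) unfolding q_def
    by (metis less_le_trans mult_le_0_iff not_le zero_le_power2)
  have C_le: "(norm (blinfun_apply C x))\<^sup>2 \<le> \<kappa> * q x" if "x \<in> V" for x
  proof -
    let ?y = "blinfun_apply C x"
    have "((norm ?y)\<^sup>2)\<^sup>2 \<le> q x * q ?y"
      using covariance_Cauchy_Schwarz[OF C, of ?y x] by (simp add: q_def power2_norm_eq_inner)
    also have "\<dots> \<le> q x * (\<kappa> * (norm ?y)\<^sup>2)"
      by (intro mult_left_mono q_le V(3) that) (simp add: q_def covariance_nonneg[OF C])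
    finally have *: "(norm ?y)\<^sup>2 * (norm ?y)\<^sup>2 \<le> (\<kappa> * q x) * (norm ?y)\<^sup>2"
      by (simp add: power2_eq_square mult_ac)
    show ?thesis
    proof (cases "?y = 0")
      case True
      then show ?thesis using \<open>\<kappa> > 0\<close> covariance_nonneg[OF C, of x] by (simp add: q_def)
    next
      case False
      then have "(norm ?y)\<^sup>2 > 0" by simp
      with * show ?thesis by (rule mult_right_le_imp_le)
    qed
  qed
  have "\<exists>x\<in>U. \<kappa> - inverse (Suc n) < q x" for n
    using less_cSup_iff[of "q ` U" "\<kappa> - inverse (Suc n)"] bdd unit[OF x0(1) \<open>x0 \<noteq> 0\<close>]
    unfolding \<kappa>_def by auto
  then obtain x where x: "\<And>n. x n \<in> U" "\<And>n. \<kappa> - inverse (Suc n) < q (x n)" by metis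
  have "blinfun_apply C (x n) \<in> closure (blinfun_apply C ` cball 0 1)" for n
    by (rule subsetD[OF closure_subset]) (use x(1) in \<open>auto simp: U_def\<close>)
  then obtain y r where r: "strict_mono r" and y: "((\<lambda>n. blinfun_apply C (x n)) \<circ> r) \<longlonglongrightarrow> y"
    using covariance_operator_compact[OF C] unfolding compact_def by metis
  have residual: "(\<lambda>n. blinfun_apply C (x n) - \<kappa> *\<^sub>R x n) \<longlonglongrightarrow> 0"
  proof -
    have bound: "(norm (blinfun_apply C (x n) - \<kappa> *\<^sub>R x n))\<^sup>2 \<le> \<kappa> * inverse (Suc n)" for n
    proof -
      have "(norm (blinfun_apply C (x n) - \<kappa> *\<^sub>R x n))\<^sup>2
          = (norm (blinfun_apply C (x n)))\<^sup>2 - 2 * \<kappa> * q (x n) + \<kappa>\<^sup>2 * (norm (x n))\<^sup>2"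
        unfolding power2_norm_eq_inner
        by (simp add: q_def inner_diff_left inner_diff_right inner_commute power2_eq_square)
      also have "\<dots> \<le> \<kappa> * q (x n) - 2 * \<kappa> * q (x n) + \<kappa>\<^sup>2"
        using C_le[of "x n"] x(1)[of n] by (simp add: U_def)
      also have "\<dots> = \<kappa> * (\<kappa> - q (x n))" by (simp add: power2_eq_square algebra_simps)
      also have "\<dots> \<le> \<kappa> * inverse (Suc n)"
        using x(2)[of n] \<open>\<kappa> > 0\<close> by (intro mult_left_mono) auto
      finally show ?thesis .
    qed
    have limit: "(\<lambda>n. \<kappa> * inverse (real (Suc n))) \<longlonglongrightarrow> \<kappa> * 0"
      by (intro tendsto_intros LIMSEQ_inverse_real_of_nat)
    have "(\<lambda>n. (norm (blinfun_apply C (x n) - \<kappa> *\<^sub>R x n))\<^sup>2) \<longlonglongrightarrow> 0"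
    proof (rule tendsto_sandwich[OF always_eventually always_eventually tendsto_const])
      show "(\<lambda>n. \<kappa> * inverse (real (Suc n))) \<longlonglongrightarrow> 0" using limit by simp
    qed (simp, rule allI, rule bound)
    then show ?thesis by (simp add: tendsto_norm_zero_iff)
  qed
  have "(\<lambda>n. inverse \<kappa> *\<^sub>R (blinfun_apply C (x (r n)) -
      (blinfun_apply C (x (r n)) - \<kappa> *\<^sub>R x (r n)))) \<longlonglongrightarrow> inverse \<kappa> *\<^sub>R (y - 0)"
    using y LIMSEQ_subseq_LIMSEQ[OF residual r] by (intro tendsto_intros) (auto simp: o_def)
  then have lim: "(\<lambda>n. x (r n)) \<longlonglongrightarrow> inverse \<kappa> *\<^sub>R y" using \<open>\<kappa> > 0\<close> by simp
  show ?thesis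
  proof
    show "inverse \<kappa> *\<^sub>R y \<in> V"
      by (rule closed_sequentially[OF V(2) _ lim]) (use x(1) in \<open>auto simp: U_def\<close>)
    have "(\<lambda>n. norm (x (r n))) \<longlonglongrightarrow> norm (inverse \<kappa> *\<^sub>R y)" by (intro tendsto_intros lim)
    moreover have "norm (x (r n)) = 1" for n using x(1) by (simp add: U_def)
    ultimately have "(\<lambda>n. 1) \<longlonglongrightarrow> norm (inverse \<kappa> *\<^sub>R y)" by simp
    then show "norm (inverse \<kappa> *\<^sub>R y) = 1" by (simp only: LIMSEQ_const_iff)
    show "\<kappa> > 0" by fact
    have "(\<lambda>n. blinfun_apply C (x (r n))) \<longlonglongrightarrow> blinfun_apply C (inverse \<kappa> *\<^sub>R y)"
      by (intro tendsto_intros lim)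
    then have "blinfun_apply C (inverse \<kappa> *\<^sub>R y) = y"
      using y LIMSEQ_unique by (auto simp: o_def)
    then show "blinfun_apply C (inverse \<kappa> *\<^sub>R y) = \<kappa> *\<^sub>R (inverse \<kappa> *\<^sub>R y)" using \<open>\<kappa> > 0\<close> by simp
  qed
qed

text \<open>By Zorn's lemma there is a maximal orthonormal set of eigenvectors with positive eigenvalues. Its
  orthogonal complement is invariant, and by maximality the quadratic form, hence \<open>C\<close>, vanishes there.
  Thus \<open>C\<close> is determined by the Fourier expansion along the eigenvectors.\<close>
lemma covariance_spectral_theorem:
  fixes C :: "'a::{real_inner, complete_space} \<Rightarrow>\<^sub>L 'a"
  assumes C: "covariance_operator C"
  shows "\<exists>E \<sigma>. spectral_decomposition C E \<sigma>"
proof -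
  define A where "A = {E. orthonormal E \<and> (\<forall>e\<in>E. \<exists>\<kappa>>0. blinfun_apply C e = \<kappa> *\<^sub>R e)}"
  have "\<exists>E\<in>A. \<forall>X\<in>A. E \<subseteq> X \<longrightarrow> X = E"
  proof (rule subset_Zorn')
    fix \<C> assume chain: "subset.chain A \<C>"
    then have "chain\<^sub>\<subseteq> \<C>" by (simp add: subset_chain_def chain_subset_def)
    then have "pairwise orthogonal (\<Union>\<C>)"
      by (rule pairwise_chain_Union[rotated])
         (use chain in \<open>auto simp: subset_chain_def A_def orthonormal_def\<close>)
    then show "\<Union>\<C> \<in> A"
      using chain by (auto simp: subset_chain_def A_def orthonormal_def)
  qed
  then obtain E where "E \<in> A" and max: "\<And>X. X \<in> A \<Longrightarrow> E \<subseteq> X \<Longrightarrow> X = E" by blast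
  then have E: "orthonormal E" and "\<forall>e\<in>E. \<exists>\<kappa>>0. blinfun_apply C e = \<kappa> *\<^sub>R e"
    by (auto simp: A_def)
  then obtain \<kappa> where \<kappa>: "\<And>e. e \<in> E \<Longrightarrow> \<kappa> e > 0" "\<And>e. e \<in> E \<Longrightarrow> blinfun_apply C e = \<kappa> e *\<^sub>R e"
    by metis
  define V where "V = {x. \<forall>e\<in>E. e \<bullet> x = 0}"
  have V: "subspace V" "closed V" "\<And>x. x \<in> V \<Longrightarrow> blinfun_apply C x \<in> V"
  proof -
    show "subspace V" by (auto simp: V_def subspace_def inner_add_right)
    have "V = (\<Inter>e\<in>E. {x. e \<bullet> x = 0})" by (auto simp: V_def)
    then show "closed V" by (auto intro!: closed_INT closed_Collect_eq continuous_intros)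
    show "blinfun_apply C x \<in> V" if "x \<in> V" for x
      using that \<kappa>(2) covariance_sym[OF C, symmetric] by (auto simp: V_def)
  qed
  have zero: "blinfun_apply C x = 0" if "x \<in> V" for x
  proof -
    have "x \<bullet> blinfun_apply C x = 0"
    proof (rule ccontr)
      assume "x \<bullet> blinfun_apply C x \<noteq> 0"
      then have "x \<bullet> blinfun_apply C x > 0" using covariance_nonneg[OF C, of x] by simp
      then obtain e l where e: "e \<in> V" "norm e = 1" "l > 0" "blinfun_apply C e = l *\<^sub>R e"
        using covariance_eigenvector_exists[OF C V \<open>x \<in> V\<close>] by blast
      have "insert e E \<in> A"
        using e \<open>E \<in> A\<close>
        by (auto simp: A_def V_def orthonormal_def pairwise_insert orthogonal_def inner_commute)
      then have "e \<in> E" using max by blast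
      then show False using e(1,2) by (auto simp: V_def)
    qed
    then show ?thesis
      using covariance_Cauchy_Schwarz[OF C, of "blinfun_apply C x" x] by simp
  qed
  have "((\<lambda>e. ((sqrt (\<kappa> e))\<^sup>2 * (e \<bullet> x)) *\<^sub>R e) has_sum blinfun_apply C x) E" for x
  proof -
    obtain p where p: "((\<lambda>e. (e \<bullet> x) *\<^sub>R e) has_sum p) E"
      using Fourier_summable[OF E, of x] by (auto simp: summable_on_def)
    have "x - p \<in> V"
      using orthonormal_coefficient[OF E p] by (simp add: V_def inner_diff_right)
    then have "blinfun_apply C x = blinfun_apply C p"
      using zero[of "x - p"] by (simp add: blinfun.diff_right)
    moreover have "((\<lambda>e. ((sqrt (\<kappa> e))\<^sup>2 * (e \<bullet> x)) *\<^sub>R e) has_sum blinfun_apply C p) E"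
    proof (rule has_sum_cong[THEN iffD1])
      show "((\<lambda>e. blinfun_apply C ((e \<bullet> x) *\<^sub>R e)) has_sum blinfun_apply C p) E"
        by (rule has_sum_bounded_linear[OF blinfun.bounded_linear_right p])
      show "blinfun_apply C ((e \<bullet> x) *\<^sub>R e) = ((sqrt (\<kappa> e))\<^sup>2 * (e \<bullet> x)) *\<^sub>R e" if "e \<in> E" for e
        using \<kappa>(1)[OF that] by (simp add: blinfun.scaleR_right \<kappa>(2)[OF that] mult.commute)
    qed
    ultimately show ?thesis by simp
  qed
  then have "spectral_decomposition C E (\<lambda>e. sqrt (\<kappa> e))"
    using E \<kappa>(1) by (auto simp: spectral_decomposition_def less_imp_le)
  then show ?thesis by blast
qed

section \<open>The Onsager--Machlup functional as a convex conjugate\<close>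

text \<open>The functional is first computed for a decomposition with strictly positive weights, where the closed
  span of \<open>E\<close> is the closure of the range of \<open>C\<close> and every weight can be inverted.\<close>
locale positive_spectral_system =
  fixes C :: "'a::{real_inner, complete_space} \<Rightarrow>\<^sub>L 'a" and E :: "'a set" and \<sigma> :: "'a \<Rightarrow> real"
  assumes decomposition: "spectral_decomposition C E \<sigma>"
    and positive: "\<And>e. e \<in> E \<Longrightarrow> \<sigma> e > 0"
begin

definition sqrt_op :: "'a \<Rightarrow> 'a" where
  "sqrt_op x = (\<Sum>\<^sub>\<infinity>e\<in>E. (\<sigma> e * (e \<bullet> x)) *\<^sub>R e)"

definition pinv_op :: "'a \<Rightarrow> 'a" where
  "pinv_op v = (\<Sum>\<^sub>\<infinity>e\<in>E. (inverse (\<sigma> e) * (e \<bullet> v)) *\<^sub>R e)"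

lemma ortho: "orthonormal E"
  using decomposition by (simp add: spectral_decomposition_def)

lemma operator_has_sum: "((\<lambda>e. ((\<sigma> e)\<^sup>2 * (e \<bullet> x)) *\<^sub>R e) has_sum blinfun_apply C x) E"
  using decomposition by (simp add: spectral_decomposition_def)

lemma quadratic_form_has_sum: "((\<lambda>e. (\<sigma> e * (e \<bullet> x))\<^sup>2) has_sum (x \<bullet> blinfun_apply C x)) E"
  using has_sum_inner[OF operator_has_sum, of x x]
  by (simp add: power2_eq_square inner_commute mult_ac)

lemma eigenvector:
  assumes "e \<in> E"
  shows "blinfun_apply C e = (\<sigma> e)\<^sup>2 *\<^sub>R e"
proof -
  have "((\<lambda>f. ((\<sigma> f)\<^sup>2 * (f \<bullet> e)) *\<^sub>R f) has_sum (\<sigma> e)\<^sup>2 *\<^sub>R e) E"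
    by (rule has_sum_finite_neutralI[of "{e}"])
       (use assms orthonormal_inner[OF ortho] in auto)
  then show ?thesis using operator_has_sum has_sum_unique by blast
qed

text \<open>The squared coefficients sum to the quadratic form of \<open>C\<close>, which also shows convergence.\<close>
lemma sqrt_op_has_sum: "((\<lambda>e. (\<sigma> e * (e \<bullet> x)) *\<^sub>R e) has_sum sqrt_op x) E"
  unfolding sqrt_op_def
  by (rule has_sum_infsum[OF Riesz_Fischer[OF ortho finite_sum_le_has_sum[OF quadratic_form_has_sum]]]) auto

lemma inner_sqrt_op: "e \<in> E \<Longrightarrow> e \<bullet> sqrt_op x = \<sigma> e * (e \<bullet> x)"
  by (rule orthonormal_coefficient[OF ortho sqrt_op_has_sum])

lemma norm_sqrt_op: "(norm (sqrt_op x))\<^sup>2 = x \<bullet> blinfun_apply C x"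
  using orthonormal_Parseval[OF ortho sqrt_op_has_sum] quadratic_form_has_sum has_sum_unique
  by blast

lemma sqrt_op_sym: "h \<bullet> sqrt_op x = sqrt_op h \<bullet> x"
proof -
  have "((\<lambda>e. \<sigma> e * (e \<bullet> x) * (e \<bullet> h)) has_sum (h \<bullet> sqrt_op x)) E" for h x
    using has_sum_inner[OF sqrt_op_has_sum, of h x] by (simp add: inner_commute)
  from this[of x h] this[of h x] show ?thesis
    by (simp add: mult_ac inner_commute) (rule has_sum_unique)
qed

text \<open>The pseudoinverse undoes the square root up to the projection onto the closed span of \<open>E\<close>.\<close>
lemma pinv_sqrt_has_sum: "((\<lambda>e. (e \<bullet> x) *\<^sub>R e) has_sum pinv_op (sqrt_op x)) E"
proof -
  have "pinv_op (sqrt_op x) = (\<Sum>\<^sub>\<infinity>e\<in>E. (e \<bullet> x) *\<^sub>R e)"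
    unfolding pinv_op_def
    by (rule infsum_cong) (use positive inner_sqrt_op in \<open>auto simp: less_imp_neq[symmetric]\<close>)
  then show ?thesis using Fourier_summable[OF ortho] by simp
qed

lemma sqrt_pinv_sqrt: "sqrt_op (pinv_op (sqrt_op x)) = sqrt_op x"
proof -
  have "e \<bullet> pinv_op (sqrt_op x) = e \<bullet> x" if "e \<in> E" for e
    by (rule orthonormal_coefficient[OF ortho pinv_sqrt_has_sum that])
  then show ?thesis
    unfolding sqrt_op_def[of x] sqrt_op_def[of "pinv_op _"] by (intro infsum_cong) simp
qed

text \<open>With \<open>S\<close> the square root and \<open>w\<close> the pseudoinverse image of \<open>v\<close>, one has \<open>v = S w\<close>, so
  \<open>h \<bullet> v = S h \<bullet> w \<le> ((norm (S h))\<^sup>2 + (norm w)\<^sup>2) / 2\<close>, and \<open>(norm (S h))\<^sup>2 = h \<bullet> C h\<close>.\<close>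
lemma energy_imp_conjugate_sublevel:
  assumes v: "v \<in> range sqrt_op" and le: "1 / 2 * (norm (pinv_op v))\<^sup>2 \<le> t"
  shows "v \<in> conjugate_sublevel C t"
  unfolding conjugate_sublevel_def
proof (intro CollectI allI)
  fix h
  let ?w = "pinv_op v"
  have "h \<bullet> v = sqrt_op h \<bullet> ?w"
    using v sqrt_pinv_sqrt sqrt_op_sym by (metis rangeE)
  also have "\<dots> \<le> norm (sqrt_op h) * norm ?w" by (rule norm_cauchy_schwarz)
  finally show "h \<bullet> v - (h \<bullet> blinfun_apply C h) / 2 \<le> t"
    using le zero_le_power2[of "norm (sqrt_op h) - norm ?w"]
    unfolding norm_sqrt_op[symmetric] power2_diff by simp
qed

text \<open>Testing with the finite sums \<open>h\<close> of the vectors \<open>(inverse (\<sigma> e))\<^sup>2 * (e \<bullet> v) *\<^sub>R e\<close> bounds every partial sum of the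
  energy by \<open>2 * t\<close>, so the series of the pseudoinverse converges. What remains of \<open>v\<close> is orthogonal to
  \<open>E\<close> and hence lies in the kernel of \<open>C\<close>; testing with large multiples of it shows that it is zero.\<close>
lemma conjugate_sublevel_imp_energy:
  assumes v: "v \<in> conjugate_sublevel C t"
  shows "v \<in> range sqrt_op \<and> 1 / 2 * (norm (pinv_op v))\<^sup>2 \<le> t"
proof -
  have bound: "(\<Sum>e\<in>F. (inverse (\<sigma> e) * (e \<bullet> v))\<^sup>2) \<le> 2 * t" if F: "finite F" "F \<subseteq> E" for F
  proof -
    define h where "h = (\<Sum>e\<in>F. ((inverse (\<sigma> e))\<^sup>2 * (e \<bullet> v)) *\<^sub>R e)"
    let ?s = "\<Sum>e\<in>F. (inverse (\<sigma> e) * (e \<bullet> v))\<^sup>2"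
    have "h \<bullet> v = ?s"
      by (simp add: h_def inner_sum_left power_mult_distrib power2_eq_square mult_ac)
    moreover have "h \<bullet> blinfun_apply C h = ?s"
    proof -
      have "blinfun_apply C h = (\<Sum>e\<in>F. (e \<bullet> v) *\<^sub>R e)"
        unfolding h_def blinfun.sum_right blinfun.scaleR_right
        by (rule sum.cong)
           (use F positive eigenvector in \<open>auto simp: less_imp_neq[symmetric] field_simps\<close>)
      then have "h \<bullet> blinfun_apply C h = (\<Sum>e\<in>F. ((inverse (\<sigma> e))\<^sup>2 * (e \<bullet> v)) * (e \<bullet> (\<Sum>e\<in>F. (e \<bullet> v) *\<^sub>R e)))"
        by (simp add: h_def inner_sum_left)
      also have "\<dots> = ?s"
        by (rule sum.cong)
           (use F orthonormal_inner_sum[OF ortho F] in \<open>auto simp: power2_eq_square\<close>)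
      finally show ?thesis .
    qed
    moreover have "h \<bullet> v - (h \<bullet> blinfun_apply C h) / 2 \<le> t"
      using v unfolding conjugate_sublevel_def by blast
    ultimately show ?thesis by simp
  qed
  have pinv: "((\<lambda>e. (inverse (\<sigma> e) * (e \<bullet> v)) *\<^sub>R e) has_sum pinv_op v) E"
    unfolding pinv_op_def by (rule has_sum_infsum[OF Riesz_Fischer[OF ortho bound]])
  have "(norm (pinv_op v))\<^sup>2 \<le> 2 * t"
    by (rule has_sum_le_finite_sums[OF orthonormal_Parseval[OF ortho pinv] bound])
  moreover have "v = sqrt_op (pinv_op v)"
  proof -
    define r where "r = v - sqrt_op (pinv_op v)"
    have r: "e \<bullet> r = 0" if "e \<in> E" for e
      using that positive[OF that] orthonormal_coefficient[OF ortho pinv that]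
      by (simp add: r_def inner_diff_right inner_sqrt_op)
    have "r \<bullet> blinfun_apply C r = 0" by (rule orthogonal_has_sum[OF operator_has_sum r])
    have "s * (r \<bullet> v) \<le> t" for s
    proof -
      have "(s *\<^sub>R r) \<bullet> v - ((s *\<^sub>R r) \<bullet> blinfun_apply C (s *\<^sub>R r)) / 2 \<le> t"
        using v unfolding conjugate_sublevel_def by blast
      then show ?thesis using \<open>r \<bullet> blinfun_apply C r = 0\<close> by (simp add: blinfun.scaleR_right)
    qed
    \<comment> \<open>If \<open>r \<bullet> v \<noteq> 0\<close>, this multiple turns the inequality into \<open>t + 1 \<le> t\<close>.\<close>
    from this[of "(t + 1) / (r \<bullet> v)"] have "r \<bullet> v = 0" by (cases "r \<bullet> v = 0") simp_all
    moreover have "r \<bullet> sqrt_op (pinv_op v) = 0" by (rule orthogonal_has_sum[OF sqrt_op_has_sum r])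
    ultimately have "r \<bullet> r = 0" by (simp add: r_def inner_diff_right)
    then show ?thesis by (simp add: r_def)
  qed
  ultimately show ?thesis by auto
qed

text \<open>Every point of finite energy is a limit of points \<open>C h\<close> whose energy does not exceed it: truncate
  \<open>v = S x\<close> to finitely many modes. Truncation only discards nonnegative terms of the energy.\<close>
lemma finite_energy_approximation:
  assumes v: "v \<in> range sqrt_op" and "\<epsilon> > 0"
  shows "\<exists>h. dist (blinfun_apply C h) v \<le> \<epsilon> \<and> h \<bullet> blinfun_apply C h \<le> (norm (pinv_op v))\<^sup>2"
proof -
  obtain x where x: "v = sqrt_op x" using v by auto
  obtain F where F: "finite F" "F \<subseteq> E" "dist (\<Sum>e\<in>F. (\<sigma> e * (e \<bullet> x)) *\<^sub>R e) v \<le> \<epsilon>"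
    using has_sum_finite_approximation[OF sqrt_op_has_sum \<open>\<epsilon> > 0\<close>, of x] x by auto
  define h where "h = (\<Sum>e\<in>F. (inverse (\<sigma> e) * (e \<bullet> x)) *\<^sub>R e)"
  have Ch: "blinfun_apply C h = (\<Sum>e\<in>F. (\<sigma> e * (e \<bullet> x)) *\<^sub>R e)"
    unfolding h_def blinfun.sum_right blinfun.scaleR_right
    by (rule sum.cong)
       (use F positive eigenvector in \<open>auto simp: less_imp_neq[symmetric] power2_eq_square\<close>)
  have "h \<bullet> blinfun_apply C h = (\<Sum>e\<in>F. (inverse (\<sigma> e) * (e \<bullet> x)) * (e \<bullet> (\<Sum>e\<in>F. (\<sigma> e * (e \<bullet> x)) *\<^sub>R e)))"
    unfolding Ch by (simp add: h_def inner_sum_left)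
  also have "\<dots> = (\<Sum>e\<in>F. (e \<bullet> x)\<^sup>2)"
  proof (rule sum.cong)
    fix e assume "e \<in> F"
    then have "\<sigma> e \<noteq> 0" "e \<bullet> (\<Sum>e\<in>F. (\<sigma> e * (e \<bullet> x)) *\<^sub>R e) = \<sigma> e * (e \<bullet> x)"
      using F positive orthonormal_inner_sum[OF ortho F(1,2)] by force+
    then show "(inverse (\<sigma> e) * (e \<bullet> x)) * (e \<bullet> (\<Sum>e\<in>F. (\<sigma> e * (e \<bullet> x)) *\<^sub>R e)) = (e \<bullet> x)\<^sup>2"
      by (simp add: power2_eq_square)
  qed simp
  also have "\<dots> \<le> (norm (pinv_op v))\<^sup>2"
    unfolding x
    by (rule finite_sum_le_has_sum[OF orthonormal_Parseval[OF ortho pinv_sqrt_has_sum] F(1,2)]) simp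
  finally have "h \<bullet> blinfun_apply C h \<le> (norm (pinv_op v))\<^sup>2" .
  then show ?thesis using F(3) unfolding Ch[symmetric] by blast
qed

end

lemma spectral_decomposition_positive_part:
  assumes "spectral_decomposition C E \<sigma>"
  shows "spectral_decomposition C {e \<in> E. \<sigma> e \<noteq> 0} \<sigma>"
proof -
  have "((\<lambda>e. ((\<sigma> e)\<^sup>2 * (e \<bullet> x)) *\<^sub>R e) has_sum blinfun_apply C x) {e \<in> E. \<sigma> e \<noteq> 0} \<longleftrightarrow>
      ((\<lambda>e. ((\<sigma> e)\<^sup>2 * (e \<bullet> x)) *\<^sub>R e) has_sum blinfun_apply C x) E" for x
    by (rule has_sum_cong_neutral) auto
  moreover have "orthonormal {e \<in> E. \<sigma> e \<noteq> 0}"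
    using assms orthonormal_subset by (fastforce simp: spectral_decomposition_def)
  ultimately show ?thesis
    using assms unfolding spectral_decomposition_def by blast
qed

text \<open>The chosen decomposition may contain zero weights. They contribute nothing to the square root and
  are excluded from the pseudoinverse, so they can be dropped.\<close>
lemma cov_sqrt_positive_system:
  assumes "covariance_operator C"
  obtains E \<sigma> where "positive_spectral_system C E \<sigma>"
    "cov_sqrt C = positive_spectral_system.sqrt_op E \<sigma>"
    "cov_sqrt_pinv C = positive_spectral_system.pinv_op E \<sigma>"
proof -
  obtain E \<sigma> where choice: "spectral_choice C = (E, \<sigma>)" by (cases "spectral_choice C")
  have "\<exists>p. spectral_decomposition C (fst p) (snd p)"
    using covariance_spectral_theorem[OF assms] by auto
  from someI_ex[OF this] have dec: "spectral_decomposition C E \<sigma>"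
    using choice by (simp add: spectral_choice_def)
  let ?E = "{e \<in> E. \<sigma> e \<noteq> 0}"
  interpret positive_spectral_system C ?E \<sigma>
  proof
    show "spectral_decomposition C ?E \<sigma>" by (rule spectral_decomposition_positive_part[OF dec])
    show "\<sigma> e > 0" if "e \<in> ?E" for e
      using dec that by (auto simp: spectral_decomposition_def less_le)
  qed
  show ?thesis
  proof
    show "positive_spectral_system C ?E \<sigma>" by unfold_locales
    show "cov_sqrt C = sqrt_op"
      unfolding cov_sqrt_def sqrt_op_def choice prod.case
      by (intro ext infsum_cong_neutral) auto
    show "cov_sqrt_pinv C = pinv_op"
      unfolding cov_sqrt_pinv_def pinv_op_def choice prod.case ..
  qed
qed

text \<open>The dual description: up to translation by the mean, the functional is the convex conjugate of the
  quadratic form of the covariance, so that its sublevel sets no longer involve square roots.\<close>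
lemma onsager_machlup_le_iff:
  fixes C :: "'a::{real_inner, complete_space} \<Rightarrow>\<^sub>L 'a"
  assumes G: "gaussian_measure M m C"
  shows "onsager_machlup M u \<le> ereal t \<longleftrightarrow> u - m \<in> conjugate_sublevel C t"
proof -
  have "covariance_operator C" using G by (simp add: gaussian_measure_def)
  then obtain E \<sigma> where sys: "positive_spectral_system C E \<sigma>"
    and ops: "cov_sqrt C = positive_spectral_system.sqrt_op E \<sigma>"
      "cov_sqrt_pinv C = positive_spectral_system.pinv_op E \<sigma>"
    by (rule cov_sqrt_positive_system)
  interpret positive_spectral_system C E \<sigma> by fact
  show ?thesis
    unfolding onsager_machlup_def gaussian_mean_eq[OF G] gaussian_cov_eq[OF G] Let_def ops
    using energy_imp_conjugate_sublevel[of "u - m" t] conjugate_sublevel_imp_energy[of "u - m" t]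
    by auto
qed

lemma onsager_machlup_approximation:
  fixes C :: "'a::{real_inner, complete_space} \<Rightarrow>\<^sub>L 'a"
  assumes G: "gaussian_measure M m C" and le: "onsager_machlup M u \<le> ereal t" and "\<epsilon> > 0"
  obtains h where "dist (m + blinfun_apply C h) u \<le> \<epsilon>" "(h \<bullet> blinfun_apply C h) / 2 \<le> t"
proof -
  have "covariance_operator C" using G by (simp add: gaussian_measure_def)
  then obtain E \<sigma> where sys: "positive_spectral_system C E \<sigma>"
    and ops: "cov_sqrt C = positive_spectral_system.sqrt_op E \<sigma>"
      "cov_sqrt_pinv C = positive_spectral_system.pinv_op E \<sigma>"
    by (rule cov_sqrt_positive_system)
  interpret positive_spectral_system C E \<sigma> by fact
  have "u - m \<in> range sqrt_op \<and> 1 / 2 * (norm (pinv_op (u - m)))\<^sup>2 \<le> t"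
    using le unfolding onsager_machlup_le_iff[OF G] by (rule conjugate_sublevel_imp_energy)
  moreover from this obtain h where "dist (blinfun_apply C h) (u - m) \<le> \<epsilon>"
    "h \<bullet> blinfun_apply C h \<le> (norm (pinv_op (u - m)))\<^sup>2"
    using finite_energy_approximation[OF _ \<open>\<epsilon> > 0\<close>] by blast
  ultimately show ?thesis
    by (intro that[of h]) (auto simp: dist_norm algebra_simps)
qed

section \<open>Convergence and equicoercivity\<close>

text \<open>At stage \<open>n\<close> choose a witness for the largest \<open>k \<le> n\<close> that has one. The bound \<open>k \<le> n\<close> guarantees
  that a largest such \<open>k\<close> exists.\<close>
lemma diagonal_selection:
  fixes Q :: "nat \<Rightarrow> nat \<Rightarrow> 'b \<Rightarrow> bool"
  assumes ev: "\<And>k. \<forall>\<^sub>F n in sequentially. \<exists>y. Q k n y"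
    and anti: "\<And>j k n y. j \<le> k \<Longrightarrow> Q k n y \<Longrightarrow> Q j n y"
  obtains y where "\<And>k. \<forall>\<^sub>F n in sequentially. Q k n (y n)"
proof -
  define K where "K n = (GREATEST k. k \<le> n \<and> (\<exists>y. Q k n y))" for n :: nat
  define y where "y n = (SOME y. Q (K n) n y)" for n
  have "\<forall>\<^sub>F n in sequentially. Q k n (y n)" for k
    using ev[of k] eventually_ge_at_top[of k]
  proof eventually_elim
    case (elim n)
    then have k: "k \<le> n \<and> (\<exists>y. Q k n y)" by simp
    have "K n \<le> n \<and> (\<exists>y. Q (K n) n y)"
      unfolding K_def by (rule GreatestI_nat[where P = "\<lambda>k. k \<le> n \<and> (\<exists>y. Q k n y)" and b = n, OF k]) simp
    then have "Q (K n) n (y n)" unfolding y_def by (meson someI_ex)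
    moreover have "k \<le> K n"
      unfolding K_def by (rule Greatest_le_nat[where P = "\<lambda>k. k \<le> n \<and> (\<exists>y. Q k n y)" and b = n, OF k]) simp
    ultimately show ?case using anti by blast
  qed
  then show ?thesis by (rule that)
qed

lemma onsager_machlup_cases:
  obtains t where "onsager_machlup M u = ereal t" | "onsager_machlup M u = \<infinity>"
proof (cases "u - gaussian_mean M \<in> range (cov_sqrt (gaussian_cov M))")
  case True
  then show ?thesis by (intro that(1)) (simp only: onsager_machlup_def Let_def if_True)
next
  case False
  then show ?thesis by (intro that(2)) (simp only: onsager_machlup_def Let_def if_False)
qed

text \<open>A convex conjugate is a supremum over \<open>h\<close> of expressions that, for fixed \<open>h\<close>, are jointly continuous
  in the point, the mean and the covariance. A value below the limit functional is exceeded at some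
  \<open>h\<close>, and the same \<open>h\<close> still exceeds it for all large \<open>n\<close>.\<close>
lemma onsager_machlup_liminf:
  fixes C :: "'a::{real_inner, complete_space} \<Rightarrow>\<^sub>L 'a"
  assumes Gs: "\<And>n. gaussian_measure (\<mu>s n) (ms n) (Cs n)" and G: "gaussian_measure \<mu> m C"
    and ms: "ms \<longlonglongrightarrow> m" and Cs: "Cs \<longlonglongrightarrow> C" and xs: "xs \<longlonglongrightarrow> x"
  shows "onsager_machlup \<mu> x \<le> liminf (\<lambda>n. onsager_machlup (\<mu>s n) (xs n))"
  unfolding le_Liminf_iff
proof (intro allI impI)
  fix y assume "y < onsager_machlup \<mu> x"
  then obtain t where t: "y < ereal t" "ereal t < onsager_machlup \<mu> x"
    using ereal_dense2 by blast
  then have "x - m \<notin> conjugate_sublevel C t"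
    unfolding onsager_machlup_le_iff[OF G, symmetric] by (simp only: not_le)
  then obtain h where h: "t < h \<bullet> (x - m) - (h \<bullet> blinfun_apply C h) / 2"
    by (auto simp: conjugate_sublevel_def not_le)
  have "(\<lambda>n. h \<bullet> (xs n - ms n) - (h \<bullet> blinfun_apply (Cs n) h) / 2)
      \<longlonglongrightarrow> h \<bullet> (x - m) - (h \<bullet> blinfun_apply C h) / 2"
    by (intro tendsto_intros xs ms Cs) simp
  from order_tendstoD(1)[OF this h]
  show "\<forall>\<^sub>F n in sequentially. y < onsager_machlup (\<mu>s n) (xs n)"
  proof eventually_elim
    case (elim n)
    then have "\<not> onsager_machlup (\<mu>s n) (xs n) \<le> ereal t"
      unfolding onsager_machlup_le_iff[OF Gs] conjugate_sublevel_def by (auto simp: not_le)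
    then show ?case using t(1) by (meson less_trans not_le)
  qed
qed

text \<open>Approximate \<open>x\<close> by \<open>m + C h\<close> with \<open>(h \<bullet> C h) / 2\<close> at most the energy \<open>t\<close> of \<open>x\<close>. Then
  \<open>m\<^sub>n + C\<^sub>n h\<close> is a competitor close to \<open>x\<close> whose energy is at most \<open>(h \<bullet> C\<^sub>n h) / 2\<close>, which converges
  to \<open>(h \<bullet> C h) / 2\<close>. Improve the approximation slowly with \<open>n\<close> by diagonal selection.\<close>
lemma onsager_machlup_recovery_sequence:
  fixes C :: "'a::{real_inner, complete_space} \<Rightarrow>\<^sub>L 'a"
  assumes Gs: "\<And>n. gaussian_measure (\<mu>s n) (ms n) (Cs n)" and G: "gaussian_measure \<mu> m C"
    and ms: "ms \<longlonglongrightarrow> m" and Cs: "Cs \<longlonglongrightarrow> C"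
  shows "\<exists>xs. xs \<longlonglongrightarrow> x \<and> onsager_machlup \<mu> x \<ge> limsup (\<lambda>n. onsager_machlup (\<mu>s n) (xs n))"
proof (cases rule: onsager_machlup_cases[of \<mu> x])
  case 2
  then show ?thesis by (intro exI[of _ "\<lambda>_. x"]) simp
next
  case (1 t)
  define Q where "Q k n y \<longleftrightarrow> dist y x < 2 * inverse (real (Suc k)) \<and>
      onsager_machlup (\<mu>s n) y \<le> ereal (t + inverse (real (Suc k)))" for k n y
  have "\<forall>\<^sub>F n in sequentially. \<exists>y. Q k n y" for k
  proof -
    define r where "r = inverse (real (Suc k))"
    have "r > 0" by (simp add: r_def)
    obtain h where h: "dist (m + blinfun_apply C h) x \<le> r" "(h \<bullet> blinfun_apply C h) / 2 \<le> t"
      using onsager_machlup_approximation[OF G _ \<open>r > 0\<close>, of x t] 1 by auto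
    have "(\<lambda>n. dist (ms n + blinfun_apply (Cs n) h) x) \<longlonglongrightarrow> dist (m + blinfun_apply C h) x"
      by (intro tendsto_intros ms Cs)
    then have "\<forall>\<^sub>F n in sequentially. dist (ms n + blinfun_apply (Cs n) h) x < 2 * r"
      by (rule order_tendstoD) (use h(1) \<open>r > 0\<close> in linarith)
    moreover have "(\<lambda>n. (h \<bullet> blinfun_apply (Cs n) h) / 2) \<longlonglongrightarrow> (h \<bullet> blinfun_apply C h) / 2"
      by (intro tendsto_intros Cs) simp
    then have "\<forall>\<^sub>F n in sequentially. (h \<bullet> blinfun_apply (Cs n) h) / 2 < t + r"
      by (rule order_tendstoD) (use h(2) \<open>r > 0\<close> in linarith)
    ultimately show ?thesis
    proof eventually_elim
      case (elim n)
      have "covariance_operator (Cs n)" using Gs by (simp add: gaussian_measure_def)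
      from covariance_image_in_conjugate_sublevel[OF this, of h]
      have "blinfun_apply (Cs n) h \<in> conjugate_sublevel (Cs n) (t + r)"
        using conjugate_sublevel_mono elim(2) by (meson less_imp_le subsetD)
      then have "onsager_machlup (\<mu>s n) (ms n + blinfun_apply (Cs n) h) \<le> ereal (t + r)"
        unfolding onsager_machlup_le_iff[OF Gs] by simp
      with elim(1) show ?case unfolding Q_def r_def by blast
    qed
  qed
  moreover have "Q j n y" if "j \<le> k" "Q k n y" for j k n y
  proof -
    have "inverse (real (Suc k)) \<le> inverse (real (Suc j))" using that(1) by simp
    then show ?thesis using that(2) unfolding Q_def
      by (meson add_left_mono ereal_less_eq(3) less_le_trans mult_left_mono order_trans zero_le_numeral)
  qed
  ultimately obtain xs where xs: "\<And>k. \<forall>\<^sub>F n in sequentially. Q k n (xs n)"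
    using diagonal_selection[of Q] by blast
  have "xs \<longlonglongrightarrow> x"
  proof (rule tendstoI)
    fix \<epsilon> :: real assume "\<epsilon> > 0"
    then obtain k where k: "inverse (real (Suc k)) < \<epsilon> / 2"
      using reals_Archimedean[of "\<epsilon> / 2"] by auto
    show "\<forall>\<^sub>F n in sequentially. dist (xs n) x < \<epsilon>"
      using xs[of k] by eventually_elim (use k in \<open>simp add: Q_def\<close>)
  qed
  moreover have "limsup (\<lambda>n. onsager_machlup (\<mu>s n) (xs n)) \<le> ereal t"
    unfolding Limsup_le_iff
  proof (intro allI impI)
    fix z assume "ereal t < z"
    then obtain s where s: "ereal t < ereal s" "ereal s < z" using ereal_dense2 by blast
    then obtain k where k: "inverse (real (Suc k)) < s - t"
      using reals_Archimedean[of "s - t"] by auto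
    show "\<forall>\<^sub>F n in sequentially. onsager_machlup (\<mu>s n) (xs n) < z"
      using xs[of k]
    proof eventually_elim
      case (elim n)
      then have "onsager_machlup (\<mu>s n) (xs n) \<le> ereal (t + inverse (real (Suc k)))" by (simp add: Q_def)
      also have "\<dots> \<le> ereal s" using k by simp
      finally show ?case using s(2) by simp
    qed
  qed
  ultimately show ?thesis using 1 by auto
qed

lemma compact_closure_convergent_sequence:
  fixes f :: "nat \<Rightarrow> 'a::complete_space"
  assumes "f \<longlonglongrightarrow> l"
  shows "compact (closure (range f))"
proof (rule compact_closure_if_near_compact)
  fix \<epsilon> :: real assume "\<epsilon> > 0"
  then obtain N where N: "\<And>n. n \<ge> N \<Longrightarrow> dist (f n) l < \<epsilon>"
    using assms by (meson metric_LIMSEQ_D)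
  have "\<exists>y\<in>insert l (f ` {..<N}). dist (f n) y < \<epsilon>" for n
  proof (cases "n < N")
    case True
    then show ?thesis using \<open>\<epsilon> > 0\<close> by (intro bexI[of _ "f n"]) auto
  next
    case False
    then show ?thesis using N[of n] by simp
  qed
  moreover have "compact (insert l (f ` {..<N}))" by (intro finite_imp_compact) simp
  ultimately show "\<exists>K. compact K \<and> (\<forall>x\<in>range f. \<exists>y\<in>K. dist x y < \<epsilon>)" by blast
qed

text \<open>The sublevel sets of all the functionals together lie within any \<open>\<epsilon>\<close> of the sum of a compact set and
  the closure of the range of the means. Hence their union is totally bounded.\<close>
lemma onsager_machlup_equicoercive:
  fixes C :: "'a::{real_inner, complete_space} \<Rightarrow>\<^sub>L 'a"
  assumes Gs: "\<And>n. gaussian_measure (\<mu>s n) (ms n) (Cs n)" and G: "gaussian_measure \<mu> m C"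
    and ms: "ms \<longlonglongrightarrow> m" and Cs: "Cs \<longlonglongrightarrow> C"
  shows "equicoercive (\<lambda>n. onsager_machlup (\<mu>s n))"
  unfolding equicoercive_def
proof
  fix t :: real
  define S where "S = (\<Union>n. {u. onsager_machlup (\<mu>s n) u \<le> ereal t})"
  have "compact (closure S)"
  proof (rule compact_closure_if_near_compact)
    fix \<epsilon> :: real assume "\<epsilon> > 0"
    have "covariance_operator C" "\<And>n. covariance_operator (Cs n)"
      using G Gs by (auto simp: gaussian_measure_def)
    from conjugate_sublevels_near_compact[OF this Cs \<open>\<epsilon> > 0\<close>, of t]
    obtain K where K: "compact K"
      "\<And>n v. v \<in> conjugate_sublevel (Cs n) t \<Longrightarrow> \<exists>y\<in>K. dist v y < \<epsilon>" by metis
    let ?L = "{a + b |a b. a \<in> closure (range ms) \<and> b \<in> K}"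
    have "compact ?L" by (rule compact_sums[OF compact_closure_convergent_sequence[OF ms] K(1)])
    moreover have "\<exists>z\<in>?L. dist u z < \<epsilon>" if "u \<in> S" for u
    proof -
      obtain n where "u - ms n \<in> conjugate_sublevel (Cs n) t"
        using \<open>u \<in> S\<close> onsager_machlup_le_iff[OF Gs] by (auto simp: S_def)
      then obtain y where "y \<in> K" "dist (u - ms n) y < \<epsilon>" using K(2) by blast
      have "ms n \<in> closure (range ms)" by (rule subsetD[OF closure_subset]) simp
      then have "ms n + y \<in> ?L" using \<open>y \<in> K\<close> by blast
      moreover have "dist u (ms n + y) < \<epsilon>"
        using \<open>dist (u - ms n) y < \<epsilon>\<close> by (simp add: dist_norm algebra_simps)
      ultimately show ?thesis by blast
    qed
    ultimately show "\<exists>K. compact K \<and> (\<forall>u\<in>S. \<exists>z\<in>K. dist u z < \<epsilon>)" by blast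
  qed
  moreover have "onsager_machlup (\<mu>s n) -` {-\<infinity>..ereal t} \<subseteq> closure S" for n
    by (rule order_trans[OF _ closure_subset]) (auto simp: S_def)
  ultimately show "\<exists>K. compact K \<and> (\<forall>n. onsager_machlup (\<mu>s n) -` {-\<infinity>..ereal t} \<subseteq> K)" by blast
qed

theorem theorem5p5:
  fixes \<mu> :: "'a::{real_inner, complete_space, second_countable_topology} measure"
    and \<mu>s :: "nat \<Rightarrow> 'a measure"
    and m :: 'a and ms :: "nat \<Rightarrow> 'a"
    and C :: "'a \<Rightarrow>\<^sub>L 'a" and Cs :: "nat \<Rightarrow> ('a \<Rightarrow>\<^sub>L 'a)"
  assumes "\<And>n. gaussian_measure (\<mu>s n) (ms n) (Cs n)"
    and "gaussian_measure \<mu> m C"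
    and "ms \<longlonglongrightarrow> m"
    and "Cs \<longlonglongrightarrow> C"
  shows "gamma_converges (\<lambda>n. onsager_machlup (\<mu>s n)) (onsager_machlup \<mu>)
         \<and> equicoercive (\<lambda>n. onsager_machlup (\<mu>s n))"
proof
  show "gamma_converges (\<lambda>n. onsager_machlup (\<mu>s n)) (onsager_machlup \<mu>)"
    unfolding gamma_converges_def
    using onsager_machlup_liminf[OF assms] onsager_machlup_recovery_sequence[OF assms] by blast
  show "equicoercive (\<lambda>n. onsager_machlup (\<mu>s n))"
    by (rule onsager_machlup_equicoercive[OF assms])
qed

end
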